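(* Let $M$ be a closed compact oriented $3$-manifold and let $\zeta\in\mathbb{C}^*$. If $\dim_{\mathbb{C}}(\mathcal{S}_\zeta(M))>\dim_{\mathbb{Q}(A)}(\mathcal{S}(M,\mathbb{Q}(A)))$, then $\mathcal{S}(M)$ has $(A-\zeta)$-torsion.
   Context: For a compact oriented $3$-manifold $M$, the Kauffman bracket skein module $\mathcal{S}(M)$ is the quotient of the free $\mathbb{Z}[A^{\pm1}]$-module on isotopy classes of framed (unoriented) links in $M$ (including the empty link) by the Kauffman relations, between framed links identical outside a ball: (K1) $L_\times = A\,L_0+A^{-1}L_\infty$, where $L_\times$ has a crossing in the ball and $L_0,L_\infty$ are its two smoothings with the usual Kauffman bracket convention; (K2) $L\sqcup O=(-A^2-A^{-2})L$, where $O$ is a trivially framed unknot contained in a ball disjoint from $L$. $\mathcal{S}(M,\mathbb{Q}(A))=\mathcal{S}(M)\otimes_{\mathbb{Z}[A^{\pm1}]}\mathbb{Q}(A)$ is the same module with $\mathbb{Q}(A)$ coefficients; for closed $M$ it is a finite-dimensional $\mathbb{Q}(A)$-vector space by the theorem of Gunningham, Jordan and Safronov. For $\zeta\in\mathbb{C}^*$, $\mathcal{S}_\zeta(M)=\mathcal{S}(M)\otimes_{A=\zeta}\mathbb{C}$. "$(A-\zeta)$-torsion": for $\zeta=\pm1$, there is a nonzero $x\in\mathcal{S}(M)$ with $(A-\zeta)^kx=0$ for some $k\ge1$; for general $\zeta$, there is a nonzero $x\in\mathcal{S}(M)\otimes_{\mathbb{Z}[A^{\pm1}]}\mathbb{C}[A^{\pm1}]$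 with $(A-\zeta)^kx=0$ for some $k\geq1$. *)

theory Defs
  imports
    "HOL-Analysis.Analysis"
    "HOL-Library.Poly_Mapping"
    "HOL-Library.Extended_Nat"
    "HOL-Computational_Algebra.Computational_Algebra"
    "HOL-Algebra.Algebraic_Closure_Type"
    "Jordan_Normal_Form.Missing_VectorSpace"
begin

section \<open>Closed oriented smooth 3-manifolds\<close>

text \<open>
  We work in the smooth category. For an open set \<open>S\<close>, \<open>smooth_on S f\<close> says that \<open>f\<close> is
  infinitely often differentiable on \<open>S\<close>.
\<close>

fun Ck_on :: "nat \<Rightarrow> 'a::real_normed_vector set \<Rightarrow> ('a \<Rightarrow> 'b::real_normed_vector) \<Rightarrow> bool" where
  "Ck_on 0 S f \<longleftrightarrow> continuous_on S f"
| "Ck_on (Suc k) S f \<longleftrightarrow>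
     (\<forall>x\<in>S. f differentiable (at x)) \<and>
     (\<forall>v. Ck_on k S (\<lambda>x. frechet_derivative f (at x) v))"

definition smooth_on :: "'a::real_normed_vector set \<Rightarrow> ('a \<Rightarrow> 'b::real_normed_vector) \<Rightarrow> bool" where
  "smooth_on S f \<longleftrightarrow> (\<forall>k. Ck_on k S f)"

type_synonym 'a chart = "'a set \<times> ('a \<Rightarrow> real^3)"

definition chart_of :: "'a topology \<Rightarrow> 'a chart \<Rightarrow> bool" where
  "chart_of M c \<longleftrightarrow> (case c of (U, \<phi>) \<Rightarrow>
     openin M U \<and> open (\<phi> ` U) \<and>
     homeomorphic_map (subtopology M U) (top_of_set (\<phi> ` U)) \<phi>)"

definition transition :: "'a chart \<Rightarrow> 'a chart \<Rightarrow> real^3 \<Rightarrow> real^3" where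
  "transition c d = snd d \<circ> inv_into (fst c) (snd c)"

definition oriented_atlas :: "'a topology \<Rightarrow> 'a chart set \<Rightarrow> bool" where
  "oriented_atlas M \<A> \<longleftrightarrow>
     (\<forall>c\<in>\<A>. chart_of M c) \<and> (\<Union>c\<in>\<A>. fst c) = topspace M \<and>
     (\<forall>c\<in>\<A>. \<forall>d\<in>\<A>. let D = snd c ` (fst c \<inter> fst d) in
        smooth_on D (transition c d) \<and>
        (\<forall>x\<in>D. det (matrix (frechet_derivative (transition c d) (at x))) > 0))"

definition closed_oriented_3manifold :: "'a topology \<Rightarrow> 'a chart set \<Rightarrow> bool" where
  "closed_oriented_3manifold M \<A> \<longleftrightarrow>
     Hausdorff_space M \<and> second_countable M \<and> compact_space M \<and> oriented_atlas M \<A>"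

text \<open>
  Smoothness of a map into the manifold, defined on an open subset \<open>W\<close> of a normed space.
  Openness of the preimages of the chart domains makes the map continuous.
\<close>

definition smooth_into :: "'a chart set \<Rightarrow> 'e::real_normed_vector set \<Rightarrow> ('e \<Rightarrow> 'a) \<Rightarrow> bool" where
  "smooth_into \<A> W f \<longleftrightarrow>
     f ` W \<subseteq> (\<Union>c\<in>\<A>. fst c) \<and>
     (\<forall>(U, \<phi>)\<in>\<A>. open (W \<inter> f -` U) \<and> smooth_on (W \<inter> f -` U) (\<phi> \<circ> f))"

definition immersion_into :: "'a chart set \<Rightarrow> 'e::real_normed_vector set \<Rightarrow> ('e \<Rightarrow> 'a) \<Rightarrow> bool" where
  "immersion_into \<A> W f \<longleftrightarrow> smooth_into \<A> W f \<and>
     (\<forall>(U, \<phi>)\<in>\<A>. \<forall>w\<in>W \<inter> f -` U. inj (frechet_derivative (\<phi> \<circ> f) (at w)))"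

definition smooth_self_map :: "'a chart set \<Rightarrow> ('a \<Rightarrow> 'a) \<Rightarrow> bool" where
  "smooth_self_map \<A> g \<longleftrightarrow>
     (\<forall>(U, \<phi>)\<in>\<A>. smooth_into \<A> (\<phi> ` U) (g \<circ> inv_into U \<phi>))"

definition diffeo :: "'a topology \<Rightarrow> 'a chart set \<Rightarrow> ('a \<Rightarrow> 'a) \<Rightarrow> bool" where
  "diffeo M \<A> g \<longleftrightarrow> bij_betw g (topspace M) (topspace M) \<and>
     smooth_self_map \<A> g \<and> smooth_self_map \<A> (inv_into (topspace M) g)"

text \<open>
  A smooth ambient isotopy. The time parameter ranges over all reals in order to avoid one-sided
  derivatives; an isotopy over the unit interval can be reparametrised to be constant near its ends.
\<close>

definition ambient_isotopy :: "'a topology \<Rightarrow> 'a chart set \<Rightarrow> (real \<Rightarrow> 'a \<Rightarrow> 'a) \<Rightarrow> bool" where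
  "ambient_isotopy M \<A> H \<longleftrightarrow>
     (\<forall>(U, \<phi>)\<in>\<A>. smooth_into \<A> (UNIV \<times> \<phi> ` U) (\<lambda>(t, y). H t (inv_into U \<phi> y))) \<and>
     (\<forall>t. diffeo M \<A> (H t)) \<and> (\<forall>x\<in>topspace M. H 0 x = x)"


section \<open>Framed links\<close>

text \<open>
  A framed link is a disjoint union of smoothly embedded annuli. It is recorded as the pair of the
  union of the cores (the underlying unoriented link) and the union of the annuli (the framing).
  The empty link is the case of no annuli.
\<close>

type_synonym 'a flink = "'a set \<times> 'a set"

definition annulus :: "complex set" where
  "annulus = {z. 1 \<le> cmod z \<and> cmod z \<le> 3}"

definition annulus_core :: "complex set" where
  "annulus_core = {z. cmod z = 2}"

definition framed_link :: "'a chart set \<Rightarrow> 'a flink \<Rightarrow> bool" where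
  "framed_link \<A> L \<longleftrightarrow> (\<exists>(n::nat) (f :: nat \<Rightarrow> complex \<Rightarrow> 'a).
     (\<forall>i<n. inj_on (f i) annulus \<and>
        (\<exists>W. open W \<and> annulus \<subseteq> W \<and> immersion_into \<A> W (f i))) \<and>
     (\<forall>i<n. \<forall>j<n. i \<noteq> j \<longrightarrow> f i ` annulus \<inter> f j ` annulus = {}) \<and>
     L = ((\<Union>i<n. f i ` annulus_core), (\<Union>i<n. f i ` annulus)))"

definition isotopic :: "'a topology \<Rightarrow> 'a chart set \<Rightarrow> 'a flink \<Rightarrow> 'a flink \<Rightarrow> bool" where
  "isotopic M \<A> L L' \<longleftrightarrow>
     (\<exists>H. ambient_isotopy M \<A> H \<and> H 1 ` fst L = fst L' \<and> H 1 ` snd L = snd L')"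

definition isotopy_class :: "'a topology \<Rightarrow> 'a chart set \<Rightarrow> 'a flink \<Rightarrow> 'a flink set" where
  "isotopy_class M \<A> L = {L'. framed_link \<A> L' \<and> isotopic M \<A> L L'}"

definition link_classes :: "'a topology \<Rightarrow> 'a chart set \<Rightarrow> 'a flink set set" where
  "link_classes M \<A> = {isotopy_class M \<A> L | L. framed_link \<A> L}"


section \<open>The Kauffman relations\<close>

text \<open>
  Balls are orientation preserving embeddings \<open>e\<close> of a neighbourhood of the cube
  \<open>[-1,1]\<^sup>3\<close>; tangle diagrams are drawn in the \<open>(x,y)\<close>-plane, seen from positive \<open>z\<close>,
  with blackboard framing.
\<close>

definition cube :: "(real^3) set" where
  "cube = {p. \<forall>i. \<bar>p $ i\<bar> \<le> 1}"

definition ball_embedding :: "'a chart set \<Rightarrow> (real^3 \<Rightarrow> 'a) \<Rightarrow> bool" where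
  "ball_embedding \<A> e \<longleftrightarrow> (\<exists>W. open W \<and> cube \<subseteq> W \<and> inj_on e W \<and> smooth_into \<A> W e \<and>
     (\<forall>(U, \<phi>)\<in>\<A>. \<forall>w\<in>W \<inter> e -` U. det (matrix (frechet_derivative (\<phi> \<circ> e) (at w))) > 0))"

text \<open>
  The tangles below depend on a half-width \<open>w\<close>: \<open>w = 0\<close> gives the core arcs and \<open>w = 1/8\<close> the
  bands. They coincide near the boundary of the cube. In the crossing the strand along the
  \<open>x\<close>-axis passes over the one along the \<open>y\<close>-axis, its height being given by \<open>h\<close>. The core
  arcs of the smoothings are the curves \<open>x - y = \<plusminus> k (x + y)\<close> and \<open>x + y = \<plusminus> k (x - y)\<close>, where
  \<open>k\<close> is a smoothed absolute value. The \<open>A\<close>-smoothing joins the two regions \<open>x, y > 0\<close> and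
  \<open>x, y < 0\<close> swept out when the over-strand is rotated counterclockwise.
\<close>

definition height_profile :: "(real \<Rightarrow> real) \<Rightarrow> bool" where
  "height_profile h \<longleftrightarrow> smooth_on UNIV h \<and> (\<forall>s. 0 \<le> h s \<and> h s < 1) \<and>
     (\<forall>s. \<bar>s\<bar> \<le> 1/8 \<longrightarrow> h s > 0) \<and> (\<forall>s. \<bar>s\<bar> \<ge> 1/2 \<longrightarrow> h s = 0)"

definition smoothed_abs :: "(real \<Rightarrow> real) \<Rightarrow> bool" where
  "smoothed_abs k \<longleftrightarrow> smooth_on UNIV k \<and> (\<forall>s. \<bar>s\<bar> \<ge> 1/2 \<longrightarrow> k s = \<bar>s\<bar>) \<and>
     (\<forall>s. \<bar>s\<bar> \<le> 1/2 \<longrightarrow> 1/4 < k s \<and> k s \<le> 1/2)"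

definition crossing :: "(real \<Rightarrow> real) \<Rightarrow> real \<Rightarrow> (real^3) set" where
  "crossing h w = {p. \<bar>p$2\<bar> \<le> w \<and> p$3 = h (p$1)} \<union> {p. \<bar>p$1\<bar> \<le> w \<and> p$3 = 0}"

definition A_smoothing :: "(real \<Rightarrow> real) \<Rightarrow> real \<Rightarrow> (real^3) set" where
  "A_smoothing k w = {p. p$3 = 0 \<and>
     (\<bar>(p$1 - p$2) - k (p$1 + p$2)\<bar> \<le> 2 * w \<or> \<bar>(p$1 - p$2) + k (p$1 + p$2)\<bar> \<le> 2 * w)}"

definition B_smoothing :: "(real \<Rightarrow> real) \<Rightarrow> real \<Rightarrow> (real^3) set" where
  "B_smoothing k w = {p. p$3 = 0 \<and>
     (\<bar>(p$1 + p$2) - k (p$1 - p$2)\<bar> \<le> 2 * w \<or> \<bar>(p$1 + p$2) + k (p$1 - p$2)\<bar> \<le> 2 * w)}"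

text \<open>
  Both cores and bands are required to match the model: the bands alone would also allow a
  band that crosses its annulus transversally to the core.
\<close>

definition meets_ball_in ::
  "(real^3 \<Rightarrow> 'a) \<Rightarrow> 'a flink \<Rightarrow> (real \<Rightarrow> (real^3) set) \<Rightarrow> bool" where
  "meets_ball_in e L T \<longleftrightarrow>
     fst L \<inter> e ` cube = e ` (T 0 \<inter> cube) \<and> snd L \<inter> e ` cube = e ` (T (1/8) \<inter> cube)"

definition agree_outside :: "(real^3 \<Rightarrow> 'a) \<Rightarrow> 'a flink \<Rightarrow> 'a flink \<Rightarrow> bool" where
  "agree_outside e L L' \<longleftrightarrow>
     fst L - e ` cube = fst L' - e ` cube \<and> snd L - e ` cube = snd L' - e ` cube"

definition kauffman_triple :: "'a chart set \<Rightarrow> 'a flink \<Rightarrow> 'a flink \<Rightarrow> 'a flink \<Rightarrow> bool" where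
  "kauffman_triple \<A> Lx L0 Li \<longleftrightarrow>
     framed_link \<A> Lx \<and> framed_link \<A> L0 \<and> framed_link \<A> Li \<and>
     (\<exists>e h k. ball_embedding \<A> e \<and> height_profile h \<and> smoothed_abs k \<and>
        meets_ball_in e Lx (crossing h) \<and> meets_ball_in e L0 (A_smoothing k) \<and>
        meets_ball_in e Li (B_smoothing k) \<and> agree_outside e Lx L0 \<and> agree_outside e Lx Li)"

definition flat_annulus :: "real \<Rightarrow> (real^3) set" where
  "flat_annulus w = {p. p$3 = 0 \<and> \<bar>sqrt ((p$1)\<^sup>2 + (p$2)\<^sup>2) - 1/2\<bar> \<le> w}"

definition adds_trivial_unknot :: "'a chart set \<Rightarrow> 'a flink \<Rightarrow> 'a flink \<Rightarrow> bool" where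
  "adds_trivial_unknot \<A> L L' \<longleftrightarrow> framed_link \<A> L \<and> framed_link \<A> L' \<and>
     (\<exists>e. ball_embedding \<A> e \<and> snd L \<inter> e ` cube = {} \<and>
        L' = (fst L \<union> e ` flat_annulus 0, snd L \<union> e ` flat_annulus (1/8)))"


section \<open>Modules given by generators and relations\<close>

text \<open>The elements of the free module on \<open>G\<close> are extended by zero outside \<open>G\<close>.\<close>

definition free_module :: "('r, 'm) ring_scheme \<Rightarrow> 'x set \<Rightarrow> ('r, 'x \<Rightarrow> 'r) module" where
  "free_module R G =
     \<lparr> carrier = {f. (\<forall>x. f x \<in> carrier R) \<and> (\<forall>x. x \<notin> G \<longrightarrow> f x = \<zero>\<^bsub>R\<^esub>) \<and> finite {x. f x \<noteq> \<zero>\<^bsub>R\<^esub>}},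
       mult = undefined, one = undefined,
       zero = (\<lambda>x. \<zero>\<^bsub>R\<^esub>), add = (\<lambda>f g x. f x \<oplus>\<^bsub>R\<^esub> g x), smult = (\<lambda>r f x. r \<otimes>\<^bsub>R\<^esub> f x) \<rparr>"

definition gen :: "('r, 'm) ring_scheme \<Rightarrow> 'x \<Rightarrow> 'x \<Rightarrow> 'r" where
  "gen R x = (\<lambda>y. if y = x then \<one>\<^bsub>R\<^esub> else \<zero>\<^bsub>R\<^esub>)"

definition quotient_module :: "('r, 'b) module \<Rightarrow> 'b set \<Rightarrow> ('r, 'b set) module" where
  "quotient_module F K =
     \<lparr> carrier = A_RCOSETS F K, mult = undefined, one = undefined,
       zero = K, add = set_add F, smult = (\<lambda>r C. \<Union>x\<in>C. a_r_coset F K (r \<odot>\<^bsub>F\<^esub> x)) \<rparr>"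

definition presented_module ::
  "('r, 'm) ring_scheme \<Rightarrow> 'x set \<Rightarrow> ('x \<Rightarrow> 'r) set \<Rightarrow> ('r, ('x \<Rightarrow> 'r) set) module" where
  "presented_module R G Q =
     quotient_module (free_module R G) (LinearCombinations.module.span R (free_module R G) Q)"

text \<open>
  Extension of scalars \<open>N \<otimes>\<^bsub>R\<^esub> S\<close> of an \<open>R\<close>-module \<open>N\<close> along a ring homomorphism
  \<open>\<phi> : R \<rightarrow> S\<close>: the \<open>S\<close>-module generated by the symbols \<open>n \<otimes> 1\<close>, which are additive in \<open>n\<close>
  and satisfy \<open>(r n) \<otimes> 1 = \<phi>(r) (n \<otimes> 1)\<close>. The tensor \<open>n \<otimes> s\<close> is \<open>s (n \<otimes> 1)\<close>.
\<close>

definition extend_scalars ::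
  "('r, 'm) ring_scheme \<Rightarrow> ('s, 'l) ring_scheme \<Rightarrow> ('r \<Rightarrow> 's) \<Rightarrow> ('r, 'n) module
     \<Rightarrow> ('s, ('n \<Rightarrow> 's) set) module" where
  "extend_scalars R S \<phi> N = (let F = free_module S (carrier N) in
     presented_module S (carrier N)
       ({gen S (m \<oplus>\<^bsub>N\<^esub> n) \<ominus>\<^bsub>F\<^esub> (gen S m \<oplus>\<^bsub>F\<^esub> gen S n) | m n. m \<in> carrier N \<and> n \<in> carrier N} \<union>
        {gen S (r \<odot>\<^bsub>N\<^esub> n) \<ominus>\<^bsub>F\<^esub> (\<phi> r \<odot>\<^bsub>F\<^esub> gen S n) | r n. r \<in> carrier R \<and> n \<in> carrier N}))"

text \<open>The library's \<open>vectorspace.dim\<close> is only meaningful for finitely generated spaces.\<close>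

definition vdim :: "('k, 'm) ring_scheme \<Rightarrow> ('k, 'v) module \<Rightarrow> enat" where
  "vdim K V = (if vectorspace.fin_dim K V then enat (vectorspace.dim K V) else \<infinity>)"

definition has_power_torsion :: "('r, 'm) ring_scheme \<Rightarrow> ('r, 'n) module \<Rightarrow> 'r \<Rightarrow> bool" where
  "has_power_torsion R N p \<longleftrightarrow>
     (\<exists>x\<in>carrier N. x \<noteq> \<zero>\<^bsub>N\<^esub> \<and> (\<exists>k::nat. k \<ge> 1 \<and> (p [^]\<^bsub>R\<^esub> k) \<odot>\<^bsub>N\<^esub> x = \<zero>\<^bsub>N\<^esub>))"


section \<open>Coefficient rings\<close>

text \<open>
  Finitely supported functions on the integers form, with convolution as product, the ring of
  Laurent polynomials; \<open>Poly_Mapping.single n c\<close> is \<open>c A\<^sup>n\<close>.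
\<close>

type_synonym 'c laurent = "int \<Rightarrow>\<^sub>0 'c"

abbreviation laurent_A :: "'c::comm_ring_1 laurent" where
  "laurent_A \<equiv> Poly_Mapping.single 1 1"

abbreviation laurent_A_inv :: "'c::comm_ring_1 laurent" where
  "laurent_A_inv \<equiv> Poly_Mapping.single (- 1) 1"

abbreviation laurent_const :: "'c::comm_ring_1 \<Rightarrow> 'c laurent" where
  "laurent_const c \<equiv> Poly_Mapping.single 0 c"

abbreviation ZA :: "int laurent ring" where "ZA \<equiv> ring_of_type_algebra"
abbreviation CA :: "complex laurent ring" where "CA \<equiv> ring_of_type_algebra"
abbreviation CC :: "complex ring" where "CC \<equiv> ring_of_type_algebra"
abbreviation QA :: "rat poly fract ring" where "QA \<equiv> ring_of_type_algebra"

text \<open>The ring homomorphism from the integral Laurent polynomials sending \<open>A\<close> to \<open>a \<noteq> 0\<close>.\<close>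

definition laurent_eval :: "'k::field \<Rightarrow> int laurent \<Rightarrow> 'k" where
  "laurent_eval a p = (\<Sum>n\<in>Poly_Mapping.keys p. of_int (Poly_Mapping.lookup p n) * a powi n)"

definition QA_var :: "rat poly fract" where
  "QA_var = Fract [:0, 1:] 1"

definition laurent_to_complex :: "int laurent \<Rightarrow> complex laurent" where
  "laurent_to_complex = Poly_Mapping.map of_int"


section \<open>Kauffman bracket skein modules\<close>

definition kauffman_relations ::
  "'a topology \<Rightarrow> 'a chart set \<Rightarrow> ('a flink set \<Rightarrow> int laurent) set" where
  "kauffman_relations M \<A> =
     (let F = free_module ZA (link_classes M \<A>); cl = (\<lambda>L. gen ZA (isotopy_class M \<A> L)) in
      {cl Lx \<ominus>\<^bsub>F\<^esub> (laurent_A \<odot>\<^bsub>F\<^esub> cl L0 \<oplus>\<^bsub>F\<^esub> laurent_A_inv \<odot>\<^bsub>F\<^esub> cl Li)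
         | Lx L0 Li. kauffman_triple \<A> Lx L0 Li} \<union>
      {cl L' \<ominus>\<^bsub>F\<^esub> ((- (laurent_A ^ 2) - laurent_A_inv ^ 2) \<odot>\<^bsub>F\<^esub> cl L)
         | L L'. adds_trivial_unknot \<A> L L'})"

definition skein_module ::
  "'a topology \<Rightarrow> 'a chart set \<Rightarrow> (int laurent, ('a flink set \<Rightarrow> int laurent) set) module" where
  "skein_module M \<A> = presented_module ZA (link_classes M \<A>) (kauffman_relations M \<A>)"

definition skein_module_QA where
  "skein_module_QA M \<A> = extend_scalars ZA QA (laurent_eval QA_var) (skein_module M \<A>)"

definition skein_module_at where
  "skein_module_at \<zeta> M \<A> = extend_scalars ZA CC (laurent_eval \<zeta>) (skein_module M \<A>)"

definition skein_module_CA where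
  "skein_module_CA M \<A> = extend_scalars ZA CA laurent_to_complex (skein_module M \<A>)"

text \<open>\<open>(A - \<zeta>)\<close>-torsion: over the integral Laurent polynomials if \<open>\<zeta> = \<plusminus>1\<close>, else over the complex ones.\<close>

definition skein_has_torsion :: "'a topology \<Rightarrow> 'a chart set \<Rightarrow> complex \<Rightarrow> bool" where
  "skein_has_torsion M \<A> \<zeta> \<longleftrightarrow>
     (if \<zeta> = 1 then has_power_torsion ZA (skein_module M \<A>) (laurent_A - laurent_const 1)
      else if \<zeta> = -1 then has_power_torsion ZA (skein_module M \<A>) (laurent_A - laurent_const (-1))
      else has_power_torsion CA (skein_module_CA M \<A>) (laurent_A - laurent_const \<zeta>))"

end

theory Submission
  imports Defs
begin

text \<open>
  Let \<open>N\<close> be the skein module. If the dimension of \<open>N\<close> at \<open>A = \<zeta>\<close> exceeds the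
  dimension \<open>d\<close> over \<open>\<rat>(A)\<close>, there are more than \<open>d\<close> elements \<open>b\<close> of \<open>N\<close>
  whose specialisations at \<open>\<zeta>\<close> are linearly independent. Over \<open>\<rat>(A)\<close> they are dependent, and
  clearing denominators gives a nontrivial relation \<open>\<Sum> g\<^sub>b b = 0\<close> with Laurent polynomial
  coefficients, already in \<open>N\<close>. Dividing all \<open>g\<^sub>b\<close> by the largest possible common power
  \<open>(A - \<zeta>)\<^sup>k\<close> leaves coefficients \<open>g'\<^sub>b\<close> that do not all vanish at \<open>\<zeta>\<close>, so
  \<open>\<Sum> g'\<^sub>b b\<close> is nonzero because its specialisation at \<open>\<zeta>\<close> is; it is killed by \<open>(A - \<zeta>)\<^sup>k\<close>.
  For \<open>\<zeta> = \<plusminus>1\<close> the division takes place over the integers, otherwise over the complex numbers.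
\<close>

section \<open>Modules given by generators and relations\<close>

lemma module_hom_finsum:
  assumes "f \<in> module_hom R M N" "Module.module R M" "Module.module R N" "x \<in> B \<rightarrow> carrier M"
  shows "f (\<Oplus>\<^bsub>M\<^esub>b\<in>B. x b) = (\<Oplus>\<^bsub>N\<^esub>b\<in>B. f (x b))"
proof -
  interpret mod_hom R M N f
    using assms by (simp add: mod_hom_def mod_hom_axioms_def)
  show ?thesis
    using assms(4)
  proof (induction B rule: infinite_finite_induct)
    case (insert b B)
    then have "x \<in> B \<rightarrow> carrier M" "x b \<in> carrier M"
      by auto
    moreover from this have "(\<lambda>b. f (x b)) \<in> B \<rightarrow> carrier N"
      by auto
    ultimately show ?case
      using insert by (simp add: M.finsum_closed)
  qed simp_all
qed

text \<open>\<open>Q\<close> is only a record with operations, so each module axiom is transported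
  from \<open>M\<close> along \<open>f\<close>; a negative of \<open>f x\<close> is \<open>f\<close>
  applied to the negative of \<open>x\<close>. This is how quotients are recognised as
  modules.\<close>

lemma module_hom_image_module:
  assumes M: "Module.module R M"
    and surj: "carrier Q = f ` carrier M"
    and f_zero: "f \<zero>\<^bsub>M\<^esub> = \<zero>\<^bsub>Q\<^esub>"
    and f_add: "\<And>x y. x \<in> carrier M \<Longrightarrow> y \<in> carrier M \<Longrightarrow> f x \<oplus>\<^bsub>Q\<^esub> f y = f (x \<oplus>\<^bsub>M\<^esub> y)"
    and f_smult: "\<And>r x. r \<in> carrier R \<Longrightarrow> x \<in> carrier M \<Longrightarrow> r \<odot>\<^bsub>Q\<^esub> f x = f (r \<odot>\<^bsub>M\<^esub> x)"
  shows "Module.module R Q"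
proof -
  interpret Module.module R M by fact
  show ?thesis
  proof (rule module_criteria)
    show "\<forall>v\<in>carrier Q. \<exists>w\<in>carrier Q. v \<oplus>\<^bsub>Q\<^esub> w = \<zero>\<^bsub>Q\<^esub>"
    proof
      fix v assume "v \<in> carrier Q"
      then obtain x where x: "x \<in> carrier M" "v = f x"
        using surj by auto
      then have "v \<oplus>\<^bsub>Q\<^esub> f (\<ominus>\<^bsub>M\<^esub> x) = \<zero>\<^bsub>Q\<^esub>"
        by (simp add: f_add M.r_neg f_zero)
      then show "\<exists>w\<in>carrier Q. v \<oplus>\<^bsub>Q\<^esub> w = \<zero>\<^bsub>Q\<^esub>"
        using surj x by blast
    qed
  qed (auto simp: surj f_add f_smult f_zero[symmetric] M.a_ac smult_assoc1 smult_l_distr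
      smult_r_distr is_cring)
qed

section \<open>Free modules on a set of generators\<close>

lemma free_module_simps:
  "\<zero>\<^bsub>free_module R G\<^esub> = (\<lambda>x. \<zero>\<^bsub>R\<^esub>)"
  "f \<oplus>\<^bsub>free_module R G\<^esub> g = (\<lambda>x. f x \<oplus>\<^bsub>R\<^esub> g x)"
  "r \<odot>\<^bsub>free_module R G\<^esub> f = (\<lambda>x. r \<otimes>\<^bsub>R\<^esub> f x)"
  by (simp_all add: free_module_def)

lemma free_module_carrier:
  "f \<in> carrier (free_module R G) \<longleftrightarrow>
    (\<forall>x. f x \<in> carrier R) \<and> (\<forall>x. x \<notin> G \<longrightarrow> f x = \<zero>\<^bsub>R\<^esub>) \<and> finite {x. f x \<noteq> \<zero>\<^bsub>R\<^esub>}"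
  by (simp add: free_module_def)

lemma free_module_is_module:
  assumes "cring R"
  shows "Module.module R (free_module R G)"
proof -
  interpret cring R by fact
  show ?thesis
  proof (rule module_criteria)
    show "\<forall>f g. f \<in> carrier (free_module R G) \<and> g \<in> carrier (free_module R G) \<longrightarrow>
        f \<oplus>\<^bsub>free_module R G\<^esub> g \<in> carrier (free_module R G)"
    proof (intro allI impI)
      fix f g assume fg: "f \<in> carrier (free_module R G) \<and> g \<in> carrier (free_module R G)"
      then have "finite ({x. f x \<noteq> \<zero>\<^bsub>R\<^esub>} \<union> {x. g x \<noteq> \<zero>\<^bsub>R\<^esub>})"
        by (simp add: free_module_carrier)
      then have "finite {x. f x \<oplus>\<^bsub>R\<^esub> g x \<noteq> \<zero>\<^bsub>R\<^esub>}"
        by (rule rev_finite_subset) auto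
      with fg show "f \<oplus>\<^bsub>free_module R G\<^esub> g \<in> carrier (free_module R G)"
        by (simp add: free_module_carrier free_module_simps)
    qed
    show "\<forall>r f. r \<in> carrier R \<and> f \<in> carrier (free_module R G) \<longrightarrow>
        r \<odot>\<^bsub>free_module R G\<^esub> f \<in> carrier (free_module R G)"
    proof (intro allI impI)
      fix r f assume rf: "r \<in> carrier R \<and> f \<in> carrier (free_module R G)"
      then have "finite {x. f x \<noteq> \<zero>\<^bsub>R\<^esub>}"
        by (simp add: free_module_carrier)
      then have "finite {x. r \<otimes>\<^bsub>R\<^esub> f x \<noteq> \<zero>\<^bsub>R\<^esub>}"
        by (rule rev_finite_subset) (use rf in auto)
      with rf show "r \<odot>\<^bsub>free_module R G\<^esub> f \<in> carrier (free_module R G)"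
        by (simp add: free_module_carrier free_module_simps)
    qed
    show "\<forall>f\<in>carrier (free_module R G). \<exists>g\<in>carrier (free_module R G).
        f \<oplus>\<^bsub>free_module R G\<^esub> g = \<zero>\<^bsub>free_module R G\<^esub>"
    proof
      fix f assume f: "f \<in> carrier (free_module R G)"
      then have "finite {x. f x \<noteq> \<zero>\<^bsub>R\<^esub>}"
        by (simp add: free_module_carrier)
      then have "finite {x. \<ominus>\<^bsub>R\<^esub> f x \<noteq> \<zero>\<^bsub>R\<^esub>}"
        by (rule rev_finite_subset) auto
      with f show "\<exists>g\<in>carrier (free_module R G).
          f \<oplus>\<^bsub>free_module R G\<^esub> g = \<zero>\<^bsub>free_module R G\<^esub>"
        by (intro bexI[of _ "\<lambda>x. \<ominus>\<^bsub>R\<^esub> f x"])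
          (auto simp: free_module_carrier free_module_simps r_neg)
    qed
  qed (use assms in \<open>auto simp: free_module_carrier free_module_simps fun_eq_iff a_ac
      m_assoc l_distr r_distr\<close>)
qed

text \<open>Negation is not a field of the record but the inverse determined by addition.
  Identifying it with multiplication by \<open>-1\<close>, which is pointwise by construction, makes
  subtraction pointwise too.\<close>

lemma free_module_minus:
  assumes "cring R" "f \<in> carrier (free_module R G)" "g \<in> carrier (free_module R G)"
  shows "f \<ominus>\<^bsub>free_module R G\<^esub> g = (\<lambda>x. f x \<ominus>\<^bsub>R\<^esub> g x)"
proof -
  interpret cring R by fact
  interpret F: Module.module R "free_module R G"
    using assms(1) by (rule free_module_is_module)
  have "(\<ominus>\<^bsub>R\<^esub> \<one>\<^bsub>R\<^esub>) \<odot>\<^bsub>free_module R G\<^esub> g = \<ominus>\<^bsub>free_module R G\<^esub> g"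
    using assms by (simp add: F.smult_l_minus)
  then have "\<ominus>\<^bsub>free_module R G\<^esub> g = (\<lambda>x. \<ominus>\<^bsub>R\<^esub> g x)"
    using assms(3) by (auto simp: free_module_simps free_module_carrier l_minus fun_eq_iff)
  then show ?thesis
    by (simp add: a_minus_def free_module_simps)
qed

lemma gen_closed:
  assumes "cring R" "x \<in> G"
  shows "gen R x \<in> carrier (free_module R G)"
proof -
  interpret cring R by fact
  have "finite {y. gen R x y \<noteq> \<zero>\<^bsub>R\<^esub>}"
    by (rule finite_subset[of _ "{x}"]) (auto simp: gen_def)
  then show ?thesis
    using assms by (auto simp: free_module_carrier gen_def)
qed

lemma free_module_expansion:
  assumes "cring R" "finite B" "B \<subseteq> G" "f \<in> carrier (free_module R G)"
    "\<And>x. x \<notin> B \<Longrightarrow> f x = \<zero>\<^bsub>R\<^esub>"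
  shows "f = (\<Oplus>\<^bsub>free_module R G\<^esub>b\<in>B. f b \<odot>\<^bsub>free_module R G\<^esub> gen R b)"
proof -
  interpret cring R by fact
  interpret F: Module.module R "free_module R G"
    using assms(1) by (rule free_module_is_module)
  show ?thesis
    using assms(2-)
  proof (induction B arbitrary: f)
    case empty
    then show ?case
      by (auto simp: free_module_simps fun_eq_iff)
  next
    case (insert b B)
    have f: "f x \<in> carrier R" for x
      using insert.prems by (simp add: free_module_carrier)
    have g: "gen R x \<in> carrier (free_module R G)" if "x \<in> insert b B" for x
      using that insert.prems by (auto intro!: gen_closed assms(1))
    \<comment> \<open>Erasing the value at \<open>b\<close> leaves a function supported in
      \<open>B\<close>, to which the induction hypothesis, stated for arbitrary \<open>f\<close>,
      applies.\<close>
    define h where "h = (\<lambda>x. if x = b then \<zero>\<^bsub>R\<^esub> else f x)"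
    have h: "h \<in> carrier (free_module R G)"
      using insert.prems(2) by (auto simp: free_module_carrier h_def elim: rev_finite_subset)
    have "h = (\<Oplus>\<^bsub>free_module R G\<^esub>b\<in>B. h b \<odot>\<^bsub>free_module R G\<^esub> gen R b)"
      using insert.prems h by (intro insert.IH) (auto simp: h_def)
    also have "\<dots> = (\<Oplus>\<^bsub>free_module R G\<^esub>b\<in>B. f b \<odot>\<^bsub>free_module R G\<^esub> gen R b)"
      using f g insert.hyps by (intro F.finsum_cong') (auto simp: h_def)
    finally have "(\<Oplus>\<^bsub>free_module R G\<^esub>b\<in>insert b B. f b \<odot>\<^bsub>free_module R G\<^esub> gen R b)
        = f b \<odot>\<^bsub>free_module R G\<^esub> gen R b \<oplus>\<^bsub>free_module R G\<^esub> h"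
      using f g insert.hyps by (subst F.finsum_insert) auto
    also have "\<dots> = f"
      using f by (auto simp: free_module_simps gen_def h_def fun_eq_iff)
    finally show ?case ..
  qed
qed

lemma free_module_lift:
  assumes "Module.module R V" "v \<in> G \<rightarrow> carrier V"
  shows "\<exists>E \<in> module_hom R (free_module R G) V. \<forall>x\<in>G. E (gen R x) = v x"
proof -
  interpret V: Module.module R V by fact
  let ?F = "free_module R G"
  let ?supp = "\<lambda>f. {x. f x \<noteq> \<zero>\<^bsub>R\<^esub>}"
  define E where "E = (\<lambda>f. \<Oplus>\<^bsub>V\<^esub>x\<in>?supp f. f x \<odot>\<^bsub>V\<^esub> v x)"
  \<comment> \<open>The sum may run over any finite set of generators containing the support, so
    that \<open>f\<close>, \<open>g\<close> and their sum, whose supports differ, can share one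
    index set.\<close>
  have E_eq: "E f = (\<Oplus>\<^bsub>V\<^esub>x\<in>B. f x \<odot>\<^bsub>V\<^esub> v x)"
    if "f \<in> carrier ?F" "finite B" "?supp f \<subseteq> B" "B \<subseteq> G" for f B
    unfolding E_def
    by (rule V.M.add.finprod_mono_neutral_cong_left)
      (use that assms(2) in \<open>auto simp: free_module_carrier Pi_def\<close>)
  have supp: "finite (?supp f)" "?supp f \<subseteq> G" "\<And>x. f x \<in> carrier R" if "f \<in> carrier ?F" for f
    using that by (auto simp: free_module_carrier)
  have v: "v x \<in> carrier V" if "x \<in> G" for x
    using that assms(2) by auto
  interpret F: Module.module R ?F
    by (rule free_module_is_module) (rule V.is_cring)
  have "E (f \<oplus>\<^bsub>?F\<^esub> g) = E f \<oplus>\<^bsub>V\<^esub> E g" if f: "f \<in> carrier ?F" and g: "g \<in> carrier ?F" for f g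
  proof -
    let ?B = "?supp f \<union> ?supp g"
    have B: "finite ?B" "?B \<subseteq> G"
      using supp f g by auto
    have "E (f \<oplus>\<^bsub>?F\<^esub> g) = (\<Oplus>\<^bsub>V\<^esub>x\<in>?B. (f \<oplus>\<^bsub>?F\<^esub> g) x \<odot>\<^bsub>V\<^esub> v x)"
      using f g by (intro E_eq[OF F.M.a_closed[OF f g] B(1) _ B(2)]) (auto simp: free_module_simps)
    also have "\<dots> = (\<Oplus>\<^bsub>V\<^esub>x\<in>?B. f x \<odot>\<^bsub>V\<^esub> v x \<oplus>\<^bsub>V\<^esub> g x \<odot>\<^bsub>V\<^esub> v x)"
      using supp[OF f] supp[OF g] v
      by (intro V.finsum_cong') (auto simp: free_module_simps V.smult_l_distr subset_iff)
    also have "\<dots> = (\<Oplus>\<^bsub>V\<^esub>x\<in>?B. f x \<odot>\<^bsub>V\<^esub> v x) \<oplus>\<^bsub>V\<^esub> (\<Oplus>\<^bsub>V\<^esub>x\<in>?B. g x \<odot>\<^bsub>V\<^esub> v x)"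
      using supp[OF f] supp[OF g] v by (intro V.finsum_addf) (auto simp: subset_iff)
    also have "\<dots> = E f \<oplus>\<^bsub>V\<^esub> E g"
      using f g B by (simp add: E_eq[of _ ?B])
    finally show ?thesis .
  qed
  moreover have "E (r \<odot>\<^bsub>?F\<^esub> f) = r \<odot>\<^bsub>V\<^esub> E f" if r: "r \<in> carrier R" and f: "f \<in> carrier ?F" for r f
  proof -
    have "E (r \<odot>\<^bsub>?F\<^esub> f) = (\<Oplus>\<^bsub>V\<^esub>x\<in>?supp f. (r \<odot>\<^bsub>?F\<^esub> f) x \<odot>\<^bsub>V\<^esub> v x)"
      using r supp[OF f] by (intro E_eq[OF F.smult_closed[OF r f]]) (auto simp: free_module_simps)
    also have "\<dots> = (\<Oplus>\<^bsub>V\<^esub>x\<in>?supp f. r \<odot>\<^bsub>V\<^esub> (f x \<odot>\<^bsub>V\<^esub> v x))"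
      using r supp[OF f] v
      by (intro V.finsum_cong') (auto simp: free_module_simps V.smult_assoc1 subset_iff)
    also have "\<dots> = r \<odot>\<^bsub>V\<^esub> E f"
      unfolding E_def using r supp[OF f] v
      by (intro V.finsum_smult[symmetric]) (auto simp: subset_iff)
    finally show ?thesis .
  qed
  moreover have "E f \<in> carrier V" if "f \<in> carrier ?F" for f
    unfolding E_def using supp[OF that] v by (intro V.M.finsum_closed) (auto simp: subset_iff)
  moreover have "E (gen R x) = v x" if "x \<in> G" for x
  proof -
    have "E (gen R x) = (\<Oplus>\<^bsub>V\<^esub>y\<in>{x}. gen R x y \<odot>\<^bsub>V\<^esub> v y)"
      using that by (intro E_eq gen_closed V.is_cring) (auto simp: gen_def)
    also have "\<dots> = v x"
      using v[OF that] by (simp add: gen_def)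
    finally show ?thesis .
  qed
  ultimately show ?thesis
    by (intro bexI[of _ E]) (auto simp: module_hom_def)
qed

section \<open>Quotients by submodules and presentations\<close>

lemma quotient_module_surj:
  assumes "LinearCombinations.submodule R K F"
  shows "Module.module R (quotient_module F K)"
    and "a_r_coset F K \<in> module_hom R F (quotient_module F K)"
    and "carrier (quotient_module F K) = a_r_coset F K ` carrier F"
    and "\<And>x. x \<in> carrier F \<Longrightarrow> a_r_coset F K x = \<zero>\<^bsub>quotient_module F K\<^esub> \<longleftrightarrow> x \<in> K"
proof -
  interpret K: LinearCombinations.submodule R K F by fact
  interpret F: Module.module R F by (rule K.module)
  let ?Q = "quotient_module F K"
  \<comment> \<open>A submodule is closed under negation because it absorbs the scalar
    \<open>-1\<close>; this makes \<open>K\<close> a subgroup, and the coset lemmas apply.\<close>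
  have neg: "\<ominus>\<^bsub>F\<^esub> x \<in> K" if "x \<in> K" for x
    using that subsetD[OF K.subset that] K.smult_closed[of "\<ominus>\<^bsub>R\<^esub> \<one>\<^bsub>R\<^esub>" x]
    by (simp add: F.smult_l_minus)
  interpret K: abelian_subgroup K F
    by (intro abelian_subgroupI3 additive_subgroupI subgroup.intro)
      (use K.subset neg F.M.abelian_group_axioms in \<open>auto simp: a_inv_def[symmetric]\<close>)
  show car: "carrier ?Q = a_r_coset F K ` carrier F"
    by (auto simp: quotient_module_def A_RCOSETS_def')
  have mem: "y \<in> a_r_coset F K x \<longleftrightarrow> (\<exists>k\<in>K. y = k \<oplus>\<^bsub>F\<^esub> x)" for x y
    by (auto simp: a_r_coset_def')
  have coset_add: "a_r_coset F K (k \<oplus>\<^bsub>F\<^esub> x) = a_r_coset F K x" if "k \<in> K" "x \<in> carrier F" for k x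
    using that K.a_repr_independence'[of "k \<oplus>\<^bsub>F\<^esub> x" x] by (auto simp: mem)
  have zero: "a_r_coset F K x = K \<longleftrightarrow> x \<in> K" if "x \<in> carrier F" for x
    using that K.a_rcos_const K.a_rcos_self by blast
  then show "\<And>x. x \<in> carrier F \<Longrightarrow> a_r_coset F K x = \<zero>\<^bsub>?Q\<^esub> \<longleftrightarrow> x \<in> K"
    by (simp add: quotient_module_def)
  have add: "a_r_coset F K x \<oplus>\<^bsub>?Q\<^esub> a_r_coset F K y = a_r_coset F K (x \<oplus>\<^bsub>F\<^esub> y)"
    if "x \<in> carrier F" "y \<in> carrier F" for x y
    using that by (simp add: quotient_module_def K.a_rcos_sum)
  have smult: "r \<odot>\<^bsub>?Q\<^esub> a_r_coset F K x = a_r_coset F K (r \<odot>\<^bsub>F\<^esub> x)"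
    if "r \<in> carrier R" "x \<in> carrier F" for r x
  proof -
    \<comment> \<open>Scalar multiplication is defined as a union over all representatives; it is a
      single coset once every representative yields the same one.\<close>
    have "a_r_coset F K (r \<odot>\<^bsub>F\<^esub> y) = a_r_coset F K (r \<odot>\<^bsub>F\<^esub> x)" if y: "y \<in> a_r_coset F K x" for y
    proof -
      obtain k where k: "k \<in> K" "y = k \<oplus>\<^bsub>F\<^esub> x"
        using y mem by blast
      then have "r \<odot>\<^bsub>F\<^esub> y = r \<odot>\<^bsub>F\<^esub> k \<oplus>\<^bsub>F\<^esub> r \<odot>\<^bsub>F\<^esub> x"
        using \<open>r \<in> carrier R\<close> \<open>x \<in> carrier F\<close> subsetD[OF K.subset k(1)]
        by (simp add: F.smult_r_distr)
      then show ?thesis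
        using k(1) \<open>r \<in> carrier R\<close> \<open>x \<in> carrier F\<close> by (simp add: coset_add)
    qed
    moreover have "x \<in> a_r_coset F K x"
      using that K.a_rcos_self by simp
    ultimately have "(\<Union>y\<in>a_r_coset F K x. a_r_coset F K (r \<odot>\<^bsub>F\<^esub> y)) = a_r_coset F K (r \<odot>\<^bsub>F\<^esub> x)"
      by blast
    then show ?thesis
      by (simp add: quotient_module_def)
  qed
  have z: "a_r_coset F K \<zero>\<^bsub>F\<^esub> = \<zero>\<^bsub>?Q\<^esub>"
    using zero[of "\<zero>\<^bsub>F\<^esub>"] by (simp add: quotient_module_def)
  show "Module.module R ?Q"
    by (rule module_hom_image_module[OF F.module_axioms car z add smult])
  show "a_r_coset F K \<in> module_hom R F ?Q"
    by (auto simp: module_hom_def add smult car)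
qed

lemma free_module_hom_expansion:
  assumes "h \<in> module_hom R (free_module R G) V" "Module.module R V" "finite B" "B \<subseteq> G"
    "f \<in> carrier (free_module R G)" "\<And>x. x \<notin> B \<Longrightarrow> f x = \<zero>\<^bsub>R\<^esub>"
  shows "h f = (\<Oplus>\<^bsub>V\<^esub>b\<in>B. f b \<odot>\<^bsub>V\<^esub> h (gen R b))"
proof -
  interpret V: Module.module R V by fact
  interpret F: Module.module R "free_module R G"
    by (rule free_module_is_module) (rule V.is_cring)
  have f: "f x \<in> carrier R" for x
    using assms(5) by (simp add: free_module_carrier)
  have g: "gen R x \<in> carrier (free_module R G)" if "x \<in> B" for x
    using that assms(4) by (auto intro!: gen_closed V.is_cring)
  have "h f = h (\<Oplus>\<^bsub>free_module R G\<^esub>b\<in>B. f b \<odot>\<^bsub>free_module R G\<^esub> gen R b)"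
    using free_module_expansion[OF V.is_cring assms(3-6)] by simp
  also have "\<dots> = (\<Oplus>\<^bsub>V\<^esub>b\<in>B. h (f b \<odot>\<^bsub>free_module R G\<^esub> gen R b))"
    using f g by (intro module_hom_finsum[OF assms(1) F.module_axioms assms(2)]) auto
  also have "\<dots> = (\<Oplus>\<^bsub>V\<^esub>b\<in>B. f b \<odot>\<^bsub>V\<^esub> h (gen R b))"
    using f g module_hom_closed[OF assms(1)]
    by (intro V.finsum_cong') (auto simp: module_hom_smult[OF assms(1)])
  finally show ?thesis .
qed

lemma presented_module_is_module:
  assumes "cring R" "Q \<subseteq> carrier (free_module R G)"
  shows "Module.module R (presented_module R G Q)"
proof -
  interpret F: Module.module R "free_module R G"
    using assms(1) by (rule free_module_is_module)
  show ?thesis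
    unfolding presented_module_def
    by (rule quotient_module_surj) (rule F.span_is_submodule[OF assms(2)])
qed

section \<open>Extension of scalars\<close>

definition extension_relations ::
  "('r, 'm) ring_scheme \<Rightarrow> ('s, 'l) ring_scheme \<Rightarrow> ('r \<Rightarrow> 's) \<Rightarrow> ('r, 'n) module \<Rightarrow> ('n \<Rightarrow> 's) set" where
  "extension_relations R S \<phi> N = (let F = free_module S (carrier N) in
     {gen S (m \<oplus>\<^bsub>N\<^esub> n) \<ominus>\<^bsub>F\<^esub> (gen S m \<oplus>\<^bsub>F\<^esub> gen S n) | m n. m \<in> carrier N \<and> n \<in> carrier N} \<union>
     {gen S (r \<odot>\<^bsub>N\<^esub> n) \<ominus>\<^bsub>F\<^esub> (\<phi> r \<odot>\<^bsub>F\<^esub> gen S n) | r n. r \<in> carrier R \<and> n \<in> carrier N})"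

text \<open>The tensor \<open>n \<otimes> 1\<close>, realised as a coset in the presentation used by
  \<open>extend_scalars\<close>.\<close>

definition tensor_one ::
  "('r, 'm) ring_scheme \<Rightarrow> ('s, 'l) ring_scheme \<Rightarrow> ('r \<Rightarrow> 's) \<Rightarrow> ('r, 'n) module \<Rightarrow> 'n \<Rightarrow> ('n \<Rightarrow> 's) set" where
  "tensor_one R S \<phi> N n = (let F = free_module S (carrier N) in
     a_r_coset F (LinearCombinations.module.span S F (extension_relations R S \<phi> N)) (gen S n))"

locale scalar_extension = N: Module.module R N + S: cring S
  for R :: "('r, 'm) ring_scheme" and S :: "('s, 'l) ring_scheme" and N :: "('r, 'n) module" +
  fixes \<phi> :: "'r \<Rightarrow> 's"
  assumes phi_closed: "\<phi> \<in> carrier R \<rightarrow> carrier S"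
begin

abbreviation "F \<equiv> free_module S (carrier N)"
abbreviation "rels \<equiv> extension_relations R S \<phi> N"
abbreviation "E \<equiv> extend_scalars R S \<phi> N"
abbreviation "\<tau> \<equiv> tensor_one R S \<phi> N"

sublocale F: Module.module S F
  by (rule free_module_is_module) (rule S.is_cring)

lemma gen_in_F [simp]: "n \<in> carrier N \<Longrightarrow> gen S n \<in> carrier F"
  by (rule gen_closed[OF S.is_cring])

lemma phi_in [simp]: "r \<in> carrier R \<Longrightarrow> \<phi> r \<in> carrier S"
  using phi_closed by auto

lemma rels_subset: "rels \<subseteq> carrier F"
  by (auto simp: extension_relations_def Let_def)

lemma extension_quotient: "E = quotient_module F (F.span rels)"
  by (simp add: extend_scalars_def presented_module_def extension_relations_def Let_def)

lemmas class_map = quotient_module_surj[OF F.span_is_submodule[OF rels_subset],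
    folded extension_quotient]

sublocale E: Module.module S E
  by (rule class_map)

lemma tensor_one_class: "\<tau> n = a_r_coset F (F.span rels) (gen S n)"
  by (simp add: tensor_one_def Let_def)

lemma tensor_one_closed [simp]: "n \<in> carrier N \<Longrightarrow> \<tau> n \<in> carrier E"
  by (auto simp: class_map tensor_one_class)

lemma class_eq:
  assumes "x \<in> carrier F" "y \<in> carrier F" "x \<ominus>\<^bsub>F\<^esub> y \<in> rels"
  shows "a_r_coset F (F.span rels) x = a_r_coset F (F.span rels) y"
proof -
  interpret mod_hom S F E "a_r_coset F (F.span rels)"
    by unfold_locales (rule class_map)
  have "x \<ominus>\<^bsub>F\<^esub> y \<in> F.span rels"
    using assms(3) F.in_own_span[OF rels_subset] by auto
  then have "a_r_coset F (F.span rels) (x \<ominus>\<^bsub>F\<^esub> y) = \<zero>\<^bsub>E\<^esub>"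
    using assms(1,2) by (subst class_map(4)) auto
  then have "a_r_coset F (F.span rels) x \<ominus>\<^bsub>E\<^esub> a_r_coset F (F.span rels) y = \<zero>\<^bsub>E\<^esub>"
    unfolding f_minus[OF assms(1,2)] .
  then show ?thesis
    using assms(1,2) E.M.minus_equality[of "a_r_coset F (F.span rels) x"
        "\<ominus>\<^bsub>E\<^esub> a_r_coset F (F.span rels) y"]
    by (simp add: a_minus_def)
qed

lemma tensor_one_add:
  assumes "m \<in> carrier N" "n \<in> carrier N"
  shows "\<tau> (m \<oplus>\<^bsub>N\<^esub> n) = \<tau> m \<oplus>\<^bsub>E\<^esub> \<tau> n"
proof -
  have "\<tau> (m \<oplus>\<^bsub>N\<^esub> n) = a_r_coset F (F.span rels) (gen S m \<oplus>\<^bsub>F\<^esub> gen S n)"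
    unfolding tensor_one_class using assms
    by (intro class_eq) (auto simp: extension_relations_def Let_def)
  then show ?thesis
    using assms by (simp add: tensor_one_class module_hom_add[OF class_map(2)])
qed

lemma tensor_one_smult:
  assumes "r \<in> carrier R" "n \<in> carrier N"
  shows "\<tau> (r \<odot>\<^bsub>N\<^esub> n) = \<phi> r \<odot>\<^bsub>E\<^esub> \<tau> n"
proof -
  have "\<tau> (r \<odot>\<^bsub>N\<^esub> n) = a_r_coset F (F.span rels) (\<phi> r \<odot>\<^bsub>F\<^esub> gen S n)"
    unfolding tensor_one_class using assms
    by (intro class_eq) (auto simp: extension_relations_def Let_def)
  then show ?thesis
    using assms by (simp add: tensor_one_class module_hom_smult[OF class_map(2)])
qed

lemma tensor_one_zero: "\<tau> \<zero>\<^bsub>N\<^esub> = \<zero>\<^bsub>E\<^esub>"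
  using tensor_one_add[of "\<zero>\<^bsub>N\<^esub>" "\<zero>\<^bsub>N\<^esub>"] by simp

lemma tensor_one_lincomb:
  assumes "B \<subseteq> carrier N" "c \<in> B \<rightarrow> carrier R"
  shows "\<tau> (\<Oplus>\<^bsub>N\<^esub>b\<in>B. c b \<odot>\<^bsub>N\<^esub> b) = (\<Oplus>\<^bsub>E\<^esub>b\<in>B. \<phi> (c b) \<odot>\<^bsub>E\<^esub> \<tau> b)"
  using assms
proof (induction B rule: infinite_finite_induct)
  case (insert b B)
  then have "(\<lambda>b. c b \<odot>\<^bsub>N\<^esub> b) \<in> B \<rightarrow> carrier N" "(\<lambda>b. \<phi> (c b) \<odot>\<^bsub>E\<^esub> \<tau> b) \<in> B \<rightarrow> carrier E"
    "c b \<in> carrier R" "b \<in> carrier N"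
    by (auto simp: Pi_def subset_iff)
  then show ?case
    using insert by (simp add: tensor_one_add tensor_one_smult N.M.finsum_closed)
qed (simp_all add: tensor_one_zero)

lemma extension_expansion:
  assumes "y \<in> carrier E"
  shows "\<exists>B c. finite B \<and> B \<subseteq> carrier N \<and> c \<in> B \<rightarrow> carrier S \<and>
    y = (\<Oplus>\<^bsub>E\<^esub>b\<in>B. c b \<odot>\<^bsub>E\<^esub> \<tau> b)"
proof -
  obtain f where f: "f \<in> carrier F" "y = a_r_coset F (F.span rels) f"
    using assms by (auto simp: class_map(3))
  let ?B = "{x. f x \<noteq> \<zero>\<^bsub>S\<^esub>}"
  have B: "finite ?B" "?B \<subseteq> carrier N" "f \<in> ?B \<rightarrow> carrier S"
    using f(1) by (auto simp: free_module_carrier)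
  have "y = (\<Oplus>\<^bsub>E\<^esub>b\<in>?B. f b \<odot>\<^bsub>E\<^esub> \<tau> b)"
    unfolding f(2) tensor_one_class
    by (rule free_module_hom_expansion[OF class_map(2,1) B(1,2) f(1)]) simp
  with B show ?thesis
    by blast
qed

text \<open>Vanishing in the quotient is traded for membership in a span. A property of all
  relations can then be proved by exhibiting a submodule that contains the defining ones.\<close>

lemma extension_relation:
  assumes "finite B" "B \<subseteq> carrier N" "c \<in> B \<rightarrow> carrier S" "(\<Oplus>\<^bsub>E\<^esub>b\<in>B. c b \<odot>\<^bsub>E\<^esub> \<tau> b) = \<zero>\<^bsub>E\<^esub>"
  shows "(\<lambda>x. if x \<in> B then c x else \<zero>\<^bsub>S\<^esub>) \<in> F.span rels"
proof -
  let ?f = "\<lambda>x. if x \<in> B then c x else \<zero>\<^bsub>S\<^esub>"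
  have f: "?f \<in> carrier F"
    using assms by (auto simp: free_module_carrier Pi_def)
  have "a_r_coset F (F.span rels) ?f = (\<Oplus>\<^bsub>E\<^esub>b\<in>B. ?f b \<odot>\<^bsub>E\<^esub> \<tau> b)"
    unfolding tensor_one_class
    by (rule free_module_hom_expansion[OF class_map(2,1) assms(1,2) f]) simp
  also have "\<dots> = (\<Oplus>\<^bsub>E\<^esub>b\<in>B. c b \<odot>\<^bsub>E\<^esub> \<tau> b)"
    using assms(2,3) by (intro E.finsum_cong') (auto simp: Pi_def subset_iff)
  finally show ?thesis
    using f assms(4) by (simp add: class_map)
qed

text \<open>This is the universal property of the tensor product, phrased for relations: an additive
  map \<open>t\<close> compatible with scalars along \<open>\<phi>\<close> kills the defining
  relations when extended to the free module, so every relation among the \<open>\<tau> b\<close>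
  also holds among the \<open>t b\<close>.\<close>

lemma extension_relation_map:
  assumes V: "Module.module S V"
    and t: "t \<in> carrier N \<rightarrow> carrier V"
      "\<And>m n. m \<in> carrier N \<Longrightarrow> n \<in> carrier N \<Longrightarrow> t (m \<oplus>\<^bsub>N\<^esub> n) = t m \<oplus>\<^bsub>V\<^esub> t n"
      "\<And>r n. r \<in> carrier R \<Longrightarrow> n \<in> carrier N \<Longrightarrow> t (r \<odot>\<^bsub>N\<^esub> n) = \<phi> r \<odot>\<^bsub>V\<^esub> t n"
    and B: "finite B" "B \<subseteq> carrier N" "c \<in> B \<rightarrow> carrier S"
    and zero: "(\<Oplus>\<^bsub>E\<^esub>b\<in>B. c b \<odot>\<^bsub>E\<^esub> \<tau> b) = \<zero>\<^bsub>E\<^esub>"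
  shows "(\<Oplus>\<^bsub>V\<^esub>b\<in>B. c b \<odot>\<^bsub>V\<^esub> t b) = \<zero>\<^bsub>V\<^esub>"
proof -
  interpret V: Module.module S V by fact
  obtain h where h: "h \<in> module_hom S F V" "\<And>n. n \<in> carrier N \<Longrightarrow> h (gen S n) = t n"
    using free_module_lift[OF V t(1)] by blast
  interpret h: mod_hom S F V h
    by unfold_locales (rule h)
  have tc: "t n \<in> carrier V" if "n \<in> carrier N" for n
    using that t(1) by auto
  have "rels \<subseteq> h.ker"
    using t(2,3) tc by (auto simp: h.ker_def extension_relations_def Let_def h(2) V.M.r_neg a_minus_def)
  then have "F.span rels \<subseteq> h.ker"
    by (rule F.span_is_subset[OF _ h.ker_is_submodule])
  with extension_relation[OF B zero]
  have "h (\<lambda>x. if x \<in> B then c x else \<zero>\<^bsub>S\<^esub>) = \<zero>\<^bsub>V\<^esub>"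
    by (auto simp: h.ker_def)
  moreover have "(\<lambda>x. if x \<in> B then c x else \<zero>\<^bsub>S\<^esub>) \<in> carrier F"
    using B by (auto simp: free_module_carrier Pi_def)
  then have "h (\<lambda>x. if x \<in> B then c x else \<zero>\<^bsub>S\<^esub>) =
      (\<Oplus>\<^bsub>V\<^esub>b\<in>B. (if b \<in> B then c b else \<zero>\<^bsub>S\<^esub>) \<odot>\<^bsub>V\<^esub> h (gen S b))"
    by (intro free_module_hom_expansion[OF h(1) V B(1,2)]) auto
  moreover have "\<dots> = (\<Oplus>\<^bsub>V\<^esub>b\<in>B. c b \<odot>\<^bsub>V\<^esub> t b)"
    using B tc by (intro V.finsum_cong') (auto simp: h(2) Pi_def subset_iff)
  ultimately show ?thesis
    by simp
qed

text \<open>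
  The functions that become \<open>R\<close>-valued relations of \<open>N\<close> after multiplication by a denominator
  form a submodule. It contains the defining relations of \<open>E\<close>, hence all relations of \<open>E\<close>.
\<close>

lemma extension_relation_clear_denominators:
  assumes hom: "\<phi> \<in> ring_hom R S"
    and inj: "\<And>r. r \<in> carrier R \<Longrightarrow> \<phi> r = \<zero>\<^bsub>S\<^esub> \<Longrightarrow> r = \<zero>\<^bsub>R\<^esub>"
    and dom: "domain S"
    and frac: "\<And>s. s \<in> carrier S \<Longrightarrow> \<exists>a\<in>carrier R. \<exists>b\<in>carrier R. \<phi> b \<noteq> \<zero>\<^bsub>S\<^esub> \<and> \<phi> b \<otimes>\<^bsub>S\<^esub> s = \<phi> a"
    and B: "finite B" "B \<subseteq> carrier N" "c \<in> B \<rightarrow> carrier S"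
    and zero: "(\<Oplus>\<^bsub>E\<^esub>b\<in>B. c b \<odot>\<^bsub>E\<^esub> \<tau> b) = \<zero>\<^bsub>E\<^esub>"
    and nz: "\<exists>b\<in>B. c b \<noteq> \<zero>\<^bsub>S\<^esub>"
  shows "\<exists>g \<in> B \<rightarrow> carrier R. (\<exists>b\<in>B. g b \<noteq> \<zero>\<^bsub>R\<^esub>) \<and> (\<Oplus>\<^bsub>N\<^esub>b\<in>B. g b \<odot>\<^bsub>N\<^esub> b) = \<zero>\<^bsub>N\<^esub>"
proof -
  interpret D: domain S by fact
  interpret \<phi>: ring_hom_cring R S \<phi>
    by (intro ring_hom_cringI N.is_cring S.is_cring hom)
  let ?FR = "free_module R (carrier N)"
  interpret FR: Module.module R ?FR
    by (rule free_module_is_module) (rule N.is_cring)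
  have "(\<lambda>n. n) \<in> carrier N \<rightarrow> carrier N"
    by simp
  \<comment> \<open>\<open>h\<close> evaluates a formal \<open>R\<close>-combination of elements of
    \<open>N\<close> inside \<open>N\<close>; its kernel consists of the relations of
    \<open>N\<close>.\<close>
  from free_module_lift[OF N.module_axioms this]
  obtain h where h: "h \<in> module_hom R ?FR N" "\<And>n. n \<in> carrier N \<Longrightarrow> h (gen R n) = n"
    by blast
  interpret h: mod_hom R ?FR N h
    by unfold_locales (rule h)
  have gR: "gen R n \<in> carrier ?FR" if "n \<in> carrier N" for n
    using that by (intro gen_closed N.is_cring)
  have gen_map: "\<phi> (gen R n x) = gen S n x" for n x
    by (simp add: gen_def)
  \<comment> \<open>\<open>q\<close> is the denominator, and \<open>g\<close> is \<open>q\<close>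
    times \<open>f\<close> with coefficients read back in \<open>R\<close>; the condition on
    \<open>h\<close> makes \<open>g\<close> a relation of \<open>N\<close>.\<close>
  define W where "W = {f \<in> carrier F. \<exists>q\<in>carrier R. \<exists>g\<in>carrier ?FR.
    \<phi> q \<noteq> \<zero>\<^bsub>S\<^esub> \<and> (\<forall>n. \<phi> (g n) = \<phi> q \<otimes>\<^bsub>S\<^esub> f n) \<and> h g = \<zero>\<^bsub>N\<^esub>}"
  have Fc: "f n \<in> carrier S" if "f \<in> carrier F" for f n
    using that by (simp add: free_module_carrier)
  have FRc: "f n \<in> carrier R" if "f \<in> carrier ?FR" for f n
    using that by (simp add: free_module_carrier)
  have W: "LinearCombinations.submodule S W F"
  proof
    show "W \<subseteq> carrier F"
      by (auto simp: W_def)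
    show "\<zero>\<^bsub>F\<^esub> \<in> W"
      unfolding W_def
      by (auto intro!: bexI[of _ "\<one>\<^bsub>R\<^esub>"] bexI[of _ "\<zero>\<^bsub>?FR\<^esub>"]) (auto simp: free_module_simps)
  next
    fix f f' assume "f \<in> W" "f' \<in> W"
    then obtain q g q' g' where w: "f \<in> carrier F" "q \<in> carrier R" "g \<in> carrier ?FR" "\<phi> q \<noteq> \<zero>\<^bsub>S\<^esub>"
      "\<And>n. \<phi> (g n) = \<phi> q \<otimes>\<^bsub>S\<^esub> f n" "h g = \<zero>\<^bsub>N\<^esub>"
      "f' \<in> carrier F" "q' \<in> carrier R" "g' \<in> carrier ?FR" "\<phi> q' \<noteq> \<zero>\<^bsub>S\<^esub>"
      "\<And>n. \<phi> (g' n) = \<phi> q' \<otimes>\<^bsub>S\<^esub> f' n" "h g' = \<zero>\<^bsub>N\<^esub>"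
      unfolding W_def by blast
    \<comment> \<open>Over the common denominator \<open>q q'\<close> the numerators become
      \<open>q' g\<close> and \<open>q g'\<close>.\<close>
    let ?g = "q' \<odot>\<^bsub>?FR\<^esub> g \<oplus>\<^bsub>?FR\<^esub> q \<odot>\<^bsub>?FR\<^esub> g'"
    have "\<phi> (?g n) = \<phi> (q \<otimes>\<^bsub>R\<^esub> q') \<otimes>\<^bsub>S\<^esub> (f \<oplus>\<^bsub>F\<^esub> f') n" for n
      using w Fc[OF w(1)] Fc[OF w(7)] FRc[OF w(3)] FRc[OF w(9)]
      by (simp add: free_module_simps S.r_distr S.m_ac)
    moreover have "h ?g = \<zero>\<^bsub>N\<^esub>" "?g \<in> carrier ?FR" "q \<otimes>\<^bsub>R\<^esub> q' \<in> carrier R" "f \<oplus>\<^bsub>F\<^esub> f' \<in> carrier F"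
      "\<phi> (q \<otimes>\<^bsub>R\<^esub> q') \<noteq> \<zero>\<^bsub>S\<^esub>"
      using w by (auto simp: D.integral_iff)
    ultimately show "f \<oplus>\<^bsub>F\<^esub> f' \<in> W"
      unfolding W_def by blast
  next
    fix s f assume s: "s \<in> carrier S" and "f \<in> W"
    then obtain q g where w: "f \<in> carrier F" "q \<in> carrier R" "g \<in> carrier ?FR" "\<phi> q \<noteq> \<zero>\<^bsub>S\<^esub>"
      "\<And>n. \<phi> (g n) = \<phi> q \<otimes>\<^bsub>S\<^esub> f n" "h g = \<zero>\<^bsub>N\<^esub>"
      unfolding W_def by blast
    obtain a b where ab: "a \<in> carrier R" "b \<in> carrier R" "\<phi> b \<noteq> \<zero>\<^bsub>S\<^esub>" "\<phi> b \<otimes>\<^bsub>S\<^esub> s = \<phi> a"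
      using frac[OF s] by blast
    \<comment> \<open>Writing \<open>s\<close> as the fraction of \<open>\<phi> a\<close> by
      \<open>\<phi> b\<close> turns the numerator into \<open>a g\<close> and the denominator into
      \<open>q b\<close>.\<close>
    let ?g = "a \<odot>\<^bsub>?FR\<^esub> g"
    have "\<phi> (?g n) = \<phi> (q \<otimes>\<^bsub>R\<^esub> b) \<otimes>\<^bsub>S\<^esub> (s \<odot>\<^bsub>F\<^esub> f) n" for n
      using w ab s Fc[OF w(1)] FRc[OF w(3)]
      by (simp add: free_module_simps S.m_ac flip: ab(4))
    moreover have "h ?g = \<zero>\<^bsub>N\<^esub>" "?g \<in> carrier ?FR" "q \<otimes>\<^bsub>R\<^esub> b \<in> carrier R" "s \<odot>\<^bsub>F\<^esub> f \<in> carrier F"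
      "\<phi> (q \<otimes>\<^bsub>R\<^esub> b) \<noteq> \<zero>\<^bsub>S\<^esub>"
      using w ab s by (auto simp: D.integral_iff)
    ultimately show "s \<odot>\<^bsub>F\<^esub> f \<in> W"
      unfolding W_def by blast
  qed
  have "rels \<subseteq> W"
  proof
    fix \<rho> assume "\<rho> \<in> rels"
    then consider m n where "m \<in> carrier N" "n \<in> carrier N"
        "\<rho> = gen S (m \<oplus>\<^bsub>N\<^esub> n) \<ominus>\<^bsub>F\<^esub> (gen S m \<oplus>\<^bsub>F\<^esub> gen S n)"
      | r n where "r \<in> carrier R" "n \<in> carrier N" "\<rho> = gen S (r \<odot>\<^bsub>N\<^esub> n) \<ominus>\<^bsub>F\<^esub> (\<phi> r \<odot>\<^bsub>F\<^esub> gen S n)"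
      by (auto simp: extension_relations_def Let_def)
    \<comment> \<open>The coefficients of a defining relation already lie in the image of
      \<open>\<phi>\<close>, so the same expression over \<open>R\<close> serves as numerator, with
      denominator \<open>1\<close>.\<close>
    then obtain g where g: "g \<in> carrier ?FR" "\<And>n. \<phi> (g n) = \<rho> n" "h g = \<zero>\<^bsub>N\<^esub>"
    proof cases
      case 1
      let ?g = "gen R (m \<oplus>\<^bsub>N\<^esub> n) \<ominus>\<^bsub>?FR\<^esub> (gen R m \<oplus>\<^bsub>?FR\<^esub> gen R n)"
      have "?g \<in> carrier ?FR" "h ?g = \<zero>\<^bsub>N\<^esub>"
        using 1 by (auto simp: gR h(2) N.M.r_neg a_minus_def)
      moreover have "\<phi> (?g x) = \<rho> x" for x
        using 1 FRc[OF gR]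
        by (simp add: free_module_minus[OF N.is_cring] free_module_minus[OF S.is_cring] gR
            FR.M.a_closed F.M.a_closed)
          (simp add: a_minus_def free_module_simps gen_map)
      ultimately show ?thesis
        using that by blast
    next
      case 2
      let ?g = "gen R (r \<odot>\<^bsub>N\<^esub> n) \<ominus>\<^bsub>?FR\<^esub> (r \<odot>\<^bsub>?FR\<^esub> gen R n)"
      have "?g \<in> carrier ?FR" "h ?g = \<zero>\<^bsub>N\<^esub>"
        using 2 by (auto simp: gR h(2) N.M.r_neg a_minus_def)
      moreover have "\<phi> (?g x) = \<rho> x" for x
        using 2 FRc[OF gR]
        by (simp add: free_module_minus[OF N.is_cring] free_module_minus[OF S.is_cring] gR)
          (simp add: a_minus_def free_module_simps gen_map)
      ultimately show ?thesis
        using that by blast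
    qed
    moreover have "\<rho> \<in> carrier F"
      using \<open>\<rho> \<in> rels\<close> rels_subset by auto
    ultimately show "\<rho> \<in> W"
      unfolding W_def using Fc[of \<rho>] by (auto intro!: bexI[of _ "\<one>\<^bsub>R\<^esub>"] bexI[of _ g])
  qed
  then have "F.span rels \<subseteq> W"
    by (rule F.span_is_subset[OF _ W])
  with extension_relation[OF B zero] have "(\<lambda>x. if x \<in> B then c x else \<zero>\<^bsub>S\<^esub>) \<in> W"
    by auto
  then obtain q g where q: "q \<in> carrier R" "\<phi> q \<noteq> \<zero>\<^bsub>S\<^esub>" and g: "g \<in> carrier ?FR"
    "\<And>n. \<phi> (g n) = \<phi> q \<otimes>\<^bsub>S\<^esub> (if n \<in> B then c n else \<zero>\<^bsub>S\<^esub>)" "h g = \<zero>\<^bsub>N\<^esub>"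
    unfolding W_def by blast
  have "g n = \<zero>\<^bsub>R\<^esub>" if "n \<notin> B" for n
    using that q g(2)[of n] by (intro inj FRc[OF g(1)]) simp
  then have "h g = (\<Oplus>\<^bsub>N\<^esub>b\<in>B. g b \<odot>\<^bsub>N\<^esub> h (gen R b))"
    by (intro free_module_hom_expansion[OF h(1) N.module_axioms B(1,2) g(1)])
  also have "\<dots> = (\<Oplus>\<^bsub>N\<^esub>b\<in>B. g b \<odot>\<^bsub>N\<^esub> b)"
    using B FRc[OF g(1)] by (intro N.finsum_cong') (auto simp: h(2) subset_iff)
  finally have "(\<Oplus>\<^bsub>N\<^esub>b\<in>B. g b \<odot>\<^bsub>N\<^esub> b) = \<zero>\<^bsub>N\<^esub>"
    using g(3) by simp
  moreover obtain b where b: "b \<in> B" "c b \<noteq> \<zero>\<^bsub>S\<^esub>"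
    using nz by blast
  \<comment> \<open>As \<open>S\<close> is a domain, the nonzero denominator cannot destroy the
    nonzero coefficient \<open>c b\<close>.\<close>
  then have "g b \<noteq> \<zero>\<^bsub>R\<^esub>"
    using q g(2)[of b] D.integral_iff[of "\<phi> q" "c b"] funcset_mem[OF B(3) b(1)] by auto
  ultimately show ?thesis
    using b(1) FRc[OF g(1)] by (intro bexI[of _ g]) auto
qed

end

section \<open>Dimensions and families of vectors\<close>

text \<open>Stated for a family because distinct elements of a module may coincide after extension
  of scalars. If \<open>t\<close> is injective, its image is too large to be independent; otherwise
  a collision is itself a relation, with coefficients \<open>1\<close> and
  \<open>-1\<close>.\<close>

lemma (in vectorspace) dependent_family:
  assumes "fin_dim" "finite B" "card B > dim" "t \<in> B \<rightarrow> carrier V"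
  shows "\<exists>c \<in> B \<rightarrow> carrier K. (\<exists>b\<in>B. c b \<noteq> \<zero>\<^bsub>K\<^esub>) \<and> (\<Oplus>\<^bsub>V\<^esub>b\<in>B. c b \<odot>\<^bsub>V\<^esub> t b) = \<zero>\<^bsub>V\<^esub>"
proof (cases "inj_on t B")
  case True
  have tB: "t ` B \<subseteq> carrier V" "finite (t ` B)"
    using assms by auto
  have "lin_dep (t ` B)"
    using li_le_dim(2)[OF assms(1) tB(1)] assms(3) card_image[OF True] by linarith
  then obtain a v where a: "a \<in> t ` B \<rightarrow> carrier K" "lincomb a (t ` B) = \<zero>\<^bsub>V\<^esub>" "v \<in> t ` B"
    "a v \<noteq> \<zero>\<^bsub>K\<^esub>"
    using finite_lin_dep[OF tB(2) _ tB(1)] by blast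
  have "(\<Oplus>\<^bsub>V\<^esub>b\<in>B. a (t b) \<odot>\<^bsub>V\<^esub> t b) = lincomb a (t ` B)"
    unfolding lincomb_def using a(1) tB(1) True
    by (intro M.finsum_reindex[symmetric]) auto
  then show ?thesis
    using a by (intro bexI[of _ "\<lambda>b. a (t b)"]) auto
next
  case False
  then obtain x y where xy: "x \<in> B" "y \<in> B" "x \<noteq> y" "t x = t y"
    by (auto simp: inj_on_def)
  define c where "c = (\<lambda>b. if b = x then \<one>\<^bsub>K\<^esub> else if b = y then \<ominus>\<^bsub>K\<^esub> \<one>\<^bsub>K\<^esub> else \<zero>\<^bsub>K\<^esub>)"
  have ty: "t y \<in> carrier V"
    using xy assms(4) by auto
  have c: "c b \<in> carrier K" for b
    by (simp add: c_def)
  have "(\<Oplus>\<^bsub>V\<^esub>b\<in>B. c b \<odot>\<^bsub>V\<^esub> t b) = (\<Oplus>\<^bsub>V\<^esub>b\<in>{x, y}. c b \<odot>\<^bsub>V\<^esub> t b)"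
    by (rule M.add.finprod_mono_neutral_cong_right)
      (use assms xy in \<open>auto simp: c_def Pi_def\<close>)
  also have "\<dots> = c x \<odot>\<^bsub>V\<^esub> t x \<oplus>\<^bsub>V\<^esub> c y \<odot>\<^bsub>V\<^esub> t y"
    using xy ty c by simp
  also have "\<dots> = \<zero>\<^bsub>V\<^esub>"
    using xy ty by (simp add: c_def smult_l_minus M.r_neg)
  finally show ?thesis
    using xy c by (intro bexI[of _ c]) (auto simp: c_def)
qed

text \<open>A maximal independent subset of a generating set is a basis, so if all finite
  independent subsets of \<open>T\<close> had at most \<open>d\<close> elements, the dimension would
  be at most \<open>d\<close>. The argument produces finite-dimensionality along the way, which also
  excludes the value \<infinity> of \<open>vdim\<close>.\<close>

lemma independent_family:
  fixes V :: "('k, 'v) module"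
  assumes V: "vectorspace K V"
    and T: "T \<subseteq> carrier V" "LinearCombinations.module.span K V T = carrier V"
    and d: "enat d < vdim K V"
  shows "\<exists>B\<subseteq>T. finite B \<and> \<not> LinearCombinations.module.lin_dep K V B \<and> d < card B"
proof (rule ccontr)
  interpret vectorspace K V by fact
  assume "\<not> ?thesis"
  then have small: "card B \<le> d" if "B \<subseteq> T" "finite B" "lin_indpt B" for B
    using that by (meson not_le)
  let ?P = "\<lambda>n. \<exists>B. B \<subseteq> T \<and> finite B \<and> lin_indpt B \<and> card B = n"
  have empty: "lin_indpt {}"
    by (simp add: lin_dep_def)
  \<comment> \<open>The bound \<open>d\<close> from the negated claim makes a greatest size exist;
    the empty set shows that some size occurs.\<close>
  define n where "n = (GREATEST n. ?P n)"
  have "?P n"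
    unfolding n_def by (rule GreatestI_nat[of ?P 0 d]) (use empty small in auto)
  then obtain B where B: "B \<subseteq> T" "finite B" "lin_indpt B" "card B = n"
    by blast
  have Bc: "B \<subseteq> carrier V"
    using B T by auto
  have "T \<subseteq> span B"
  proof
    fix v assume v: "v \<in> T"
    show "v \<in> span B"
    proof (rule ccontr)
      assume nv: "v \<notin> span B"
      then have vB: "v \<notin> B"
        using in_own_span[OF Bc] by auto
      then have "lin_indpt (insert v B)"
        using nv lin_dep_iff_in_span[OF Bc B(3) _ vB] v T by auto
      then have "?P (Suc n)"
        using B v vB by (intro exI[of _ "insert v B"]) auto
      then have "Suc n \<le> n"
        unfolding n_def by (rule Greatest_le_nat[of ?P _ d]) (use small in auto)
      then show False
        by simp
    qed
  qed
  then have "span T \<subseteq> span B"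
    using span_is_submodule[OF Bc] by (rule span_is_subset)
  then have gen: "span B = carrier V"
    using T span_is_subset2[OF Bc] by auto
  then have "fin_dim"
    using B Bc by (auto simp: fin_dim_def)
  moreover have "dim = card B"
    using B Bc gen by (intro dim_basis) (auto simp: basis_def)
  ultimately have "vdim K V \<le> enat d"
    using small[OF B(1-3)] by (simp add: vdim_def)
  then show False
    using d by simp
qed

lemma (in vectorspace) independent_family_coefficients:
  assumes "finite B" "inj_on t B" "t \<in> B \<rightarrow> carrier V" "lin_indpt (t ` B)" "c \<in> B \<rightarrow> carrier K"
    "(\<Oplus>\<^bsub>V\<^esub>b\<in>B. c b \<odot>\<^bsub>V\<^esub> t b) = \<zero>\<^bsub>V\<^esub>" "b \<in> B"
  shows "c b = \<zero>\<^bsub>K\<^esub>"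
proof (rule ccontr)
  assume nz: "c b \<noteq> \<zero>\<^bsub>K\<^esub>"
  define a where "a = (\<lambda>v. c (inv_into B t v))"
  have a: "a (t x) = c x" if "x \<in> B" for x
    using that assms(2) by (simp add: a_def)
  have "lincomb a (t ` B) = (\<Oplus>\<^bsub>V\<^esub>b\<in>B. a (t b) \<odot>\<^bsub>V\<^esub> t b)"
    unfolding lincomb_def using assms(2,3,5) a
    by (intro M.finsum_reindex) (auto simp: Pi_def)
  also have "\<dots> = (\<Oplus>\<^bsub>V\<^esub>b\<in>B. c b \<odot>\<^bsub>V\<^esub> t b)"
    using assms(3,5) a by (intro M.finsum_cong') (auto simp: Pi_def)
  finally have "lin_dep (t ` B)"
    using assms a nz by (intro lin_dep_crit[of "t ` B" _ a "t b"]) auto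
  then show False
    using assms(4) by simp
qed

section \<open>Laurent polynomials\<close>

text \<open>Finitely supported functions are sums of monomials, so additive identities, and by
  nested induction multiplicative ones, reduce to monomials.\<close>

lemma poly_mapping_single_induct [case_names zero single add]:
  assumes "P 0" "\<And>n c. P (Poly_Mapping.single n c)" "\<And>p q. P p \<Longrightarrow> P q \<Longrightarrow> P (p + q)"
  shows "P (p :: 'a \<Rightarrow>\<^sub>0 'b::monoid_add)"
proof (induction p rule: update_induct)
  case const
  show ?case by fact
next
  case (update p a b)
  \<comment> \<open>The key \<open>a\<close> is new, so updating it amounts to adding a
    monomial.\<close>
  have "Poly_Mapping.update a b p = p + Poly_Mapping.single a b"
    using update(1)
    by (intro poly_mapping_eqI) (auto simp: lookup_update lookup_add lookup_single in_keys_iff when_def)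
  then show ?case
    using assms(2,3) update(3) by simp
qed

text \<open>The coefficient map \<open>h\<close> is a parameter because three evaluations occur:
  integers into the complex numbers, integers into rational functions, and complex numbers into
  themselves.\<close>

definition laurent_hom_eval :: "('c::comm_ring_1 \<Rightarrow> 'k::field) \<Rightarrow> 'k \<Rightarrow> 'c laurent \<Rightarrow> 'k" where
  "laurent_hom_eval h a p = (\<Sum>n\<in>Poly_Mapping.keys p. h (Poly_Mapping.lookup p n) * a powi n)"

lemma laurent_eval_eq: "laurent_eval a = laurent_hom_eval of_int a"
  by (simp add: laurent_eval_def laurent_hom_eval_def fun_eq_iff)

locale coefficient_hom =
  fixes h :: "'c::comm_ring_1 \<Rightarrow> 'k::field" and a :: 'k
  assumes h_add: "h (x + y) = h x + h y" and h_mult: "h (x * y) = h x * h y" and h_1: "h 1 = 1"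
    and a_nz: "a \<noteq> 0"
begin

lemma h_0 [simp]: "h 0 = 0"
  by (metis add.right_neutral add_left_imp_eq h_add)

abbreviation "ev \<equiv> laurent_hom_eval h a"

lemma eval_add: "ev (p + q) = ev p + ev q"
  unfolding laurent_hom_eval_def
  by (rule setsum_keys_plus_distrib[where f = "\<lambda>n c. h c * a powi n"])
    (simp_all add: h_add algebra_simps)

lemma eval_0: "ev 0 = 0"
  by (simp add: laurent_hom_eval_def)

lemma eval_single: "ev (Poly_Mapping.single n c) = h c * a powi n"
  by (simp add: laurent_hom_eval_def)

lemma eval_1: "ev 1 = 1"
  using eval_single[of 0 1] by (simp add: h_1)

lemma eval_mult: "ev (p * q) = ev p * ev q"
proof (induction p rule: poly_mapping_single_induct)
  case (single n c)
  show ?case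
  proof (induction q rule: poly_mapping_single_induct)
    case (single m d)
    have "a powi (n + m) = a powi n * a powi m"
      using a_nz by (simp add: power_int_add)
    then show ?case
      by (simp only: mult_single eval_single h_mult mult.assoc mult.left_commute)
  qed (simp_all add: eval_0 eval_add distrib_left)
qed (simp_all add: eval_0 eval_add distrib_right)

end

section \<open>Ordinary polynomials among the Laurent polynomials\<close>

definition laurent_of_poly :: "'c::comm_ring_1 poly \<Rightarrow> 'c laurent" where
  "laurent_of_poly p = poly (map_poly laurent_const p) laurent_A"

lemma laurent_of_poly_0 [simp]: "laurent_of_poly 0 = 0"
  by (simp add: laurent_of_poly_def)

lemma laurent_of_poly_pCons [simp]:
  "laurent_of_poly (pCons c p) = laurent_const c + laurent_A * laurent_of_poly p"
  by (simp add: laurent_of_poly_def map_poly_pCons)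

lemma laurent_of_poly_add: "laurent_of_poly (p + q) = laurent_of_poly p + laurent_of_poly q"
  by (induction p q rule: poly_induct2) (simp_all add: single_add algebra_simps)

lemma laurent_of_poly_smult: "laurent_of_poly (Polynomial.smult c p) = laurent_const c * laurent_of_poly p"
  by (induction p) (simp_all add: distrib_left mult_single mult.left_commute)

lemma laurent_of_poly_mult: "laurent_of_poly (p * q) = laurent_of_poly p * laurent_of_poly q"
  by (induction p) (simp_all add: laurent_of_poly_add laurent_of_poly_smult algebra_simps)

lemma laurent_of_poly_power: "laurent_of_poly (p ^ n) = laurent_of_poly p ^ n"
proof (induction n)
  case 0
  show ?case
    by (simp add: one_pCons del: pCons_one)
qed (simp add: laurent_of_poly_mult)

lemma (in coefficient_hom) eval_laurent_of_poly:
  "ev (laurent_of_poly p) = poly (map_poly h p) a"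
  by (induction p) (simp_all add: eval_0 eval_add eval_mult eval_single h_1 map_poly_pCons)

text \<open>Asking for all sufficiently large shifts rather than for one lets both summands of a sum
  be treated with the same shift \<open>max m1 m2\<close>.\<close>

lemma laurent_shift_to_poly:
  "\<exists>m. \<forall>m'\<ge>m. \<exists>P. Poly_Mapping.single (int m') 1 * p = laurent_of_poly P"
proof (induction p rule: poly_mapping_single_induct)
  case zero
  show ?case
    by (metis laurent_of_poly_0 mult_zero_right)
next
  case (single n c)
  have A: "Poly_Mapping.single (int k) c = laurent_of_poly (Polynomial.monom c k)" for k
  proof (induction k)
    case (Suc k)
    then have "laurent_of_poly (Polynomial.monom c (Suc k)) = laurent_A * Poly_Mapping.single (int k) c"
      by (simp add: monom_Suc)
    then show ?case
      by (simp add: mult_single)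
  qed (simp add: monom_0)
  have "Poly_Mapping.single (int m') 1 * Poly_Mapping.single n c = laurent_of_poly (Polynomial.monom c (nat (int m' + n)))"
    if "m' \<ge> nat (- n)" for m'
  proof -
    have "int (nat (int m' + n)) = int m' + n"
      using that by linarith
    then show ?thesis
      using A[of "nat (int m' + n)"] by (simp only: mult_single mult_1)
  qed
  then show ?case
    by blast
next
  case (add p q)
  then obtain m1 m2 where
    "\<forall>m'\<ge>m1. \<exists>P. Poly_Mapping.single (int m') 1 * p = laurent_of_poly P"
    "\<forall>m'\<ge>m2. \<exists>P. Poly_Mapping.single (int m') 1 * q = laurent_of_poly P"
    by blast
  then show ?case
    by (intro exI[of _ "max m1 m2"]) (metis distrib_left laurent_of_poly_add max.bounded_iff)
qed

lemma laurent_family_shift_to_poly: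
  fixes p :: "'a \<Rightarrow> 'b::comm_ring_1 laurent"
  assumes "finite B"
  shows "\<exists>m P. \<forall>b\<in>B. p b = Poly_Mapping.single (- int m) 1 * laurent_of_poly (P b)"
proof -
  have "\<forall>b. \<exists>m. \<forall>m'\<ge>m. \<exists>P. Poly_Mapping.single (int m') 1 * p b = laurent_of_poly P"
    using laurent_shift_to_poly by blast
  then obtain m where m: "\<And>b m'. m' \<ge> m b \<Longrightarrow> \<exists>P. Poly_Mapping.single (int m') 1 * p b = laurent_of_poly P"
    by (auto dest!: choice)
  \<comment> \<open>The sum dominates every \<open>m b\<close>, so one shift works for the whole
    family.\<close>
  define M where "M = (\<Sum>b\<in>B. m b)"
  have "m b \<le> M" if "b \<in> B" for b
    unfolding M_def using assms that by (intro member_le_sum) auto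
  then have "\<forall>b\<in>B. \<exists>P. Poly_Mapping.single (int M) 1 * p b = laurent_of_poly P"
    using m by blast
  then obtain P where P: "\<And>b. b \<in> B \<Longrightarrow> Poly_Mapping.single (int M) 1 * p b = laurent_of_poly (P b)"
    by (auto dest!: bchoice)
  have unit: "Poly_Mapping.single (- int M) 1 * Poly_Mapping.single (int M) 1 = (1 :: 'b laurent)"
    by (simp add: mult_single)
  have "p b = Poly_Mapping.single (- int M) 1 * laurent_of_poly (P b)" if "b \<in> B" for b
    by (simp only: P[OF that, symmetric] mult.assoc[symmetric] unit mult_1)
  then show ?thesis
    by blast
qed

text \<open>Only the factor \<open>X - u\<close> is divided out, so the quotients keep their coefficients in \<open>'c\<close>.\<close>

lemma laurent_family_divide_root:
  fixes p :: "'b \<Rightarrow> 'c::idom laurent" and h :: "'c \<Rightarrow> 'k::field"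
  assumes h: "coefficient_hom h (h u)" and inj: "\<And>c. h c = 0 \<Longrightarrow> c = 0"
    and B: "finite B" "\<exists>b\<in>B. p b \<noteq> 0"
  shows "\<exists>k p'. (\<forall>b\<in>B. p b = (laurent_A - laurent_const u) ^ k * p' b) \<and>
    (\<exists>b\<in>B. laurent_hom_eval h (h u) (p' b) \<noteq> 0)"
proof -
  interpret coefficient_hom h "h u" by fact
  obtain m P where P: "\<And>b. b \<in> B \<Longrightarrow> p b = Poly_Mapping.single (- int m) 1 * laurent_of_poly (P b)"
    using laurent_family_shift_to_poly[OF B(1), of p] by blast
  have ex: "\<exists>b. b \<in> B \<and> P b \<noteq> 0"
    using B(2) P by (metis laurent_of_poly_0 mult_zero_right)
  \<comment> \<open>\<open>b0\<close> has the smallest order of vanishing at \<open>u\<close> among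
    the nonzero members; that order is the common power to remove. Zero members are divisible by any
    power.\<close>
  define b0 where "b0 = arg_min (\<lambda>b. Polynomial.order u (P b)) (\<lambda>b. b \<in> B \<and> P b \<noteq> 0)"
  define k where "k = Polynomial.order u (P b0)"
  have b0: "b0 \<in> B" "P b0 \<noteq> 0"
    unfolding b0_def using arg_min_natI[of "\<lambda>b. b \<in> B \<and> P b \<noteq> 0"] ex by blast+
  have min: "k \<le> Polynomial.order u (P b)" if "b \<in> B" "P b \<noteq> 0" for b
    unfolding k_def b0_def using that by (intro arg_min_nat_le) auto
  have "[:- u, 1:] ^ k dvd P b" if "b \<in> B" for b
    using min that by (auto simp: order_divides)
  then obtain Q where Q: "\<And>b. b \<in> B \<Longrightarrow> P b = [:- u, 1:] ^ k * Q b"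
    unfolding dvd_def by metis
  \<comment> \<open>A further factor at \<open>b0\<close> would contradict its order being exactly
    \<open>k\<close>.\<close>
  have nz: "poly (Q b0) u \<noteq> 0"
  proof
    assume "poly (Q b0) u = 0"
    then have "[:- u, 1:] ^ k * [:- u, 1:] dvd [:- u, 1:] ^ k * Q b0"
      by (intro mult_dvd_mono) (simp_all add: poly_eq_0_iff_dvd)
    then have "[:- u, 1:] ^ Suc k dvd P b0"
      using Q[OF b0(1)] by (simp only: power_Suc2)
    then show False
      using b0(2) by (auto simp: order_divides k_def simp del: power_Suc)
  qed
  \<comment> \<open>Evaluation at \<open>h u\<close> gives \<open>h\<close> of the value at
    \<open>u\<close>, so injectivity of \<open>h\<close> carries nonvanishing over.\<close>
  have hom_poly: "poly (map_poly h q) (h u) = h (poly q u)" for q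
    by (induction q) (simp_all add: map_poly_pCons h_add h_mult)
  define p' where "p' = (\<lambda>b. Poly_Mapping.single (- int m) 1 * laurent_of_poly (Q b))"
  have "laurent_of_poly [:- u, 1:] = laurent_const (- u) + laurent_A * laurent_const 1"
    by (simp only: laurent_of_poly_pCons laurent_of_poly_0 mult_zero_right add_0_right)
  also have "\<dots> = laurent_A - laurent_const u"
    by (simp add: mult_single single_uminus)
  finally have root: "laurent_of_poly [:- u, 1:] = laurent_A - laurent_const u" .
  have "p b = (laurent_A - laurent_const u) ^ k * p' b" if "b \<in> B" for b
    unfolding P[OF that] Q[OF that] p'_def laurent_of_poly_mult laurent_of_poly_power root
    by (rule mult.left_commute)
  then have "\<forall>b\<in>B. p b = (laurent_A - laurent_const u) ^ k * p' b"
    by blast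
  moreover have "ev (p' b0) \<noteq> 0"
    using nz inj a_nz
    by (auto simp: p'_def eval_mult eval_single h_1 eval_laurent_of_poly hom_poly)
  ultimately show ?thesis
    using b0(1) by blast
qed

section \<open>Rational functions as fractions of integral Laurent polynomials\<close>

lemma rat_poly_clear_denominators:
  "\<exists>n P. n \<noteq> 0 \<and> Polynomial.smult (of_int n) p = (map_poly of_int P :: rat poly)"
proof (induction p)
  case 0
  show ?case
    by (intro exI[of _ 1] exI[of _ 0]) simp
next
  case (pCons c p)
  obtain n P where n: "n \<noteq> 0" "Polynomial.smult (of_int n) p = map_poly of_int P"
    using pCons by blast
  obtain i j where "quotient_of c = (i, j)"
    by fastforce
  then have c: "c = of_int i / of_int j" and "j > 0"
    by (simp_all add: quotient_of_div quotient_of_denom_pos)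
  from c \<open>j > 0\<close> have "Polynomial.smult (of_int (n * j)) (pCons c p) =
      pCons (of_int (i * n)) (Polynomial.smult (of_int j) (Polynomial.smult (of_int n) p))"
    by (simp add: mult.commute)
  also have "\<dots> = map_poly of_int (pCons (i * n) (Polynomial.smult j P))"
    unfolding n(2) by (simp add: map_poly_pCons map_poly_smult)
  finally have "Polynomial.smult (of_int (n * j)) (pCons c p) =
      map_poly of_int (pCons (i * n) (Polynomial.smult j P))" .
  moreover have "n * j \<noteq> 0"
    using n(1) \<open>j > 0\<close> by simp
  ultimately show ?case
    by blast
qed

lemma QA_var_to_fract: "QA_var = to_fract [:0, 1:]"
  by (simp add: QA_var_def to_fract_def)

lemma coefficient_hom_QA: "coefficient_hom of_int QA_var"
  by unfold_locales (simp_all add: QA_var_to_fract)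

text \<open>Evaluating at the variable is the chain of inclusions from integral to rational
  polynomials to rational functions, so questions about \<open>laurent_eval QA_var\<close> reduce to
  questions about polynomials.\<close>

lemma laurent_eval_QA_of_poly:
  "laurent_eval QA_var (laurent_of_poly P) = to_fract (map_poly of_int P)"
proof -
  interpret coefficient_hom of_int QA_var
    by (rule coefficient_hom_QA)
  have to_fract_int: "to_fract [:of_int c:] = (of_int c :: rat poly fract)" for c
  proof (induction c rule: int_induct[of _ 0])
    case (step1 c)
    have "[:of_int (c + 1) :: rat:] = [:of_int c:] + 1"
      by (simp add: one_pCons)
    then show ?case
      using step1 by (simp only: to_fract_add to_fract_1 of_int_add of_int_1)
  next
    case (step2 c)
    have "[:of_int (c - 1) :: rat:] = [:of_int c:] - 1"
      by (simp add: one_pCons)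
    then show ?case
      using step2 by (simp only: to_fract_diff to_fract_1 of_int_diff of_int_1)
  qed simp
  have "poly (map_poly of_int P) QA_var = to_fract (map_poly of_int P)"
  proof (induction P)
    case (pCons c P)
    have "(map_poly of_int (pCons c P) :: rat poly) = [:of_int c:] + [:0, 1:] * map_poly of_int P"
      by (simp add: map_poly_pCons)
    then have "to_fract (map_poly of_int (pCons c P) :: rat poly) =
        of_int c + QA_var * to_fract (map_poly of_int P)"
      by (simp only: to_fract_add to_fract_mult to_fract_int QA_var_to_fract)
    then show ?case
      using pCons by (simp add: map_poly_pCons)
  qed simp
  then show ?thesis
    by (simp add: laurent_eval_eq eval_laurent_of_poly)
qed

lemma laurent_eval_QA_fractions:
  "\<exists>p q. laurent_eval QA_var q \<noteq> 0 \<and> laurent_eval QA_var q * x = laurent_eval QA_var p"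
proof -
  obtain r s where x: "x = to_fract r / to_fract s" "s \<noteq> 0"
    by (cases x) (auto simp: Fract_conv_to_fract)
  obtain m P where m: "m \<noteq> 0" "Polynomial.smult (of_int m) r = map_poly of_int P"
    using rat_poly_clear_denominators by blast
  obtain n Q where n: "n \<noteq> 0" "Polynomial.smult (of_int n) s = map_poly of_int Q"
    using rat_poly_clear_denominators by blast
  \<comment> \<open>\<open>P\<close> is \<open>m r\<close> and \<open>Q\<close> is
    \<open>n s\<close>, so scaling crosswise by \<open>n\<close> and \<open>m\<close> gives
    numerator and denominator the common factor \<open>m n\<close>, which cancels.\<close>
  have "map_poly of_int (Polynomial.smult m Q) = [:of_int (m * n):] * s"
    "map_poly of_int (Polynomial.smult n P) = [:of_int (m * n):] * r"
    by (simp_all add: map_poly_smult mult.commute flip: m(2) n(2))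
  then have "laurent_eval QA_var (laurent_of_poly (Polynomial.smult m Q)) = to_fract [:of_int (m * n):] * to_fract s"
    "laurent_eval QA_var (laurent_of_poly (Polynomial.smult n P)) = to_fract [:of_int (m * n):] * to_fract r"
    by (simp_all only: laurent_eval_QA_of_poly to_fract_mult)
  moreover have "to_fract [:of_int (m * n) :: rat:] \<noteq> 0"
    using m(1) n(1) by simp
  ultimately show ?thesis
    using x
    by (intro exI[of _ "laurent_of_poly (Polynomial.smult n P)"]
        exI[of _ "laurent_of_poly (Polynomial.smult m Q)"]) simp
qed

lemma laurent_eval_QA_inj:
  assumes "laurent_eval QA_var p = 0"
  shows "p = 0"
proof -
  interpret coefficient_hom of_int QA_var
    by (rule coefficient_hom_QA)
  obtain m P where P: "p = Poly_Mapping.single (- int m) 1 * laurent_of_poly P"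
    using laurent_family_shift_to_poly[of "{()}" "\<lambda>_. p"] by auto
  have "laurent_eval QA_var (laurent_of_poly P) = 0"
    using assms P a_nz by (simp add: laurent_eval_eq eval_mult eval_single)
  then have "map_poly of_int P = (0 :: rat poly)"
    by (simp add: laurent_eval_QA_of_poly)
  then have "P = 0"
    by (simp add: map_poly_eq_0_iff)
  then show ?thesis
    using P by simp
qed

lemma laurent_to_complex_eq_0_iff: "laurent_to_complex p = 0 \<longleftrightarrow> p = 0"
  by (simp add: laurent_to_complex_def map_eq_zero_iff) (metis in_keys_iff poly_mapping_eqI lookup_zero)

text \<open>Evaluation of integral Laurent polynomials factors through complex coefficients. This
  makes the specialisation a target for maps out of the extension to complex Laurent
  polynomials.\<close>

lemma laurent_hom_eval_to_complex: "laurent_hom_eval id z (laurent_to_complex p) = laurent_eval z p"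
proof -
  have "Poly_Mapping.lookup (laurent_to_complex p) n = of_int (Poly_Mapping.lookup p n)" for n
    by (simp add: laurent_to_complex_def Poly_Mapping.map.rep_eq when_def)
  moreover from this have "Poly_Mapping.keys (laurent_to_complex p) = Poly_Mapping.keys p"
    by (auto simp: in_keys_iff)
  ultimately show ?thesis
    by (simp add: laurent_hom_eval_def laurent_eval_def)
qed

section \<open>Torsion in skein modules\<close>

definition restrict_scalars :: "('r \<Rightarrow> 's) \<Rightarrow> ('s, 'v) module \<Rightarrow> ('r, 'v) module" where
  "restrict_scalars \<psi> V = \<lparr>carrier = carrier V, mult = mult V, one = one V, zero = zero V, add = add V,
    smult = (\<lambda>r. smult V (\<psi> r))\<rparr>"

lemma restrict_scalars_simps [simp]:
  "carrier (restrict_scalars \<psi> V) = carrier V" "\<zero>\<^bsub>restrict_scalars \<psi> V\<^esub> = \<zero>\<^bsub>V\<^esub>"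
  "x \<oplus>\<^bsub>restrict_scalars \<psi> V\<^esub> y = x \<oplus>\<^bsub>V\<^esub> y" "r \<odot>\<^bsub>restrict_scalars \<psi> V\<^esub> x = \<psi> r \<odot>\<^bsub>V\<^esub> x"
  by (simp_all add: restrict_scalars_def)

text \<open>Along evaluation at \<zeta>, the specialised module becomes a module over the complex
  Laurent polynomials, as \<open>extension_relation_map\<close> demands of its target.\<close>

lemma restrict_scalars_module:
  assumes "cring R" "Module.module S V" "\<psi> \<in> ring_hom R S"
  shows "Module.module R (restrict_scalars \<psi> V)"
proof -
  interpret V: Module.module S V by fact
  interpret \<psi>: ring_hom_cring R S \<psi>
    by (intro ring_hom_cringI assms V.is_cring)
  show ?thesis
  proof (rule module_criteria)
    show "\<forall>v\<in>carrier (restrict_scalars \<psi> V). \<exists>w\<in>carrier (restrict_scalars \<psi> V).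
        v \<oplus>\<^bsub>restrict_scalars \<psi> V\<^esub> w = \<zero>\<^bsub>restrict_scalars \<psi> V\<^esub>"
      using V.M.r_neg V.M.a_inv_closed by force
  qed (auto simp: V.M.a_ac V.smult_assoc1 V.smult_l_distr V.smult_r_distr assms(1))
qed

lemma restrict_scalars_finsum:
  assumes "Module.module R (restrict_scalars \<psi> V)" "Module.module S V" "f \<in> B \<rightarrow> carrier V"
  shows "finsum (restrict_scalars \<psi> V) f B = finsum V f B"
proof -
  interpret W: Module.module R "restrict_scalars \<psi> V" by fact
  interpret V: Module.module S V by fact
  show ?thesis
    using assms(3)
  proof (induction B rule: infinite_finite_induct)
    case (insert b B)
    then have "f \<in> B \<rightarrow> carrier V" "f b \<in> carrier V"
      by auto
    then show ?case
      using insert by (simp add: W.M.finsum_insert V.M.finsum_insert)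
  qed (simp_all add: W.M.finsum_infinite V.M.finsum_infinite)
qed

lemma has_power_torsionI:
  fixes k :: nat
  assumes N: "Module.module R N" and B: "finite B" "x \<in> B \<rightarrow> carrier N"
    and p: "r \<in> carrier R" "q \<in> B \<rightarrow> carrier R" "\<And>b. b \<in> B \<Longrightarrow> p b = (r [^]\<^bsub>R\<^esub> k) \<otimes>\<^bsub>R\<^esub> q b"
    and zero: "(\<Oplus>\<^bsub>N\<^esub>b\<in>B. p b \<odot>\<^bsub>N\<^esub> x b) = \<zero>\<^bsub>N\<^esub>" and nz: "(\<Oplus>\<^bsub>N\<^esub>b\<in>B. q b \<odot>\<^bsub>N\<^esub> x b) \<noteq> \<zero>\<^bsub>N\<^esub>"
  shows "has_power_torsion R N r"
proof -
  interpret N: Module.module R N by fact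
  have terms: "q b \<odot>\<^bsub>N\<^esub> x b \<in> carrier N" if "b \<in> B" for b
    using that B p by (auto simp: Pi_def)
  let ?y = "\<Oplus>\<^bsub>N\<^esub>b\<in>B. q b \<odot>\<^bsub>N\<^esub> x b"
  have y: "?y \<in> carrier N"
    using terms by (intro N.M.finsum_closed) auto
  have "(r [^]\<^bsub>R\<^esub> k) \<odot>\<^bsub>N\<^esub> ?y = (\<Oplus>\<^bsub>N\<^esub>b\<in>B. (r [^]\<^bsub>R\<^esub> k) \<odot>\<^bsub>N\<^esub> (q b \<odot>\<^bsub>N\<^esub> x b))"
    using B p terms by (intro N.finsum_smult) auto
  also have "\<dots> = (\<Oplus>\<^bsub>N\<^esub>b\<in>B. p b \<odot>\<^bsub>N\<^esub> x b)"
    using B p by (intro N.finsum_cong') (auto simp: N.smult_assoc1 Pi_def)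
  finally have *: "(r [^]\<^bsub>R\<^esub> k) \<odot>\<^bsub>N\<^esub> ?y = \<zero>\<^bsub>N\<^esub>"
    using zero by simp
  \<comment> \<open>Torsion asks for a positive exponent. With \<open>k = 0\<close> the killed
    element would be \<open>?y\<close> itself, contrary to \<open>nz\<close>.\<close>
  have "k \<noteq> 0"
  proof
    assume "k = 0"
    then show False
      using * nz y by simp
  qed
  then show ?thesis
    unfolding has_power_torsion_def using * y nz by (intro bexI[of _ ?y] conjI exI[of _ k]) simp_all
qed

text \<open>This allows independent vectors of a specialisation to be picked among the tensors
  \<open>n \<otimes> 1\<close>. Since \<open>\<tau>\<close> may identify elements of
  \<open>B\<close>, sums over \<open>B\<close> are placed in the span by induction on
  \<open>B\<close>.\<close>

lemma (in scalar_extension) span_tensor_one: "E.span (\<tau> ` carrier N) = carrier E"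
proof
  have T: "\<tau> ` carrier N \<subseteq> carrier E"
    by auto
  then show "E.span (\<tau> ` carrier N) \<subseteq> carrier E"
    by (rule E.span_is_subset2)
  interpret W: LinearCombinations.submodule S "E.span (\<tau> ` carrier N)" E
    by (rule E.span_is_submodule[OF T])
  have sub: "\<tau> b \<in> E.span (\<tau> ` carrier N)" if "b \<in> carrier N" for b
    using E.in_own_span[OF T] that by auto
  have lincomb: "(\<Oplus>\<^bsub>E\<^esub>b\<in>B. c b \<odot>\<^bsub>E\<^esub> \<tau> b) \<in> E.span (\<tau> ` carrier N)"
    if "finite B" "B \<subseteq> carrier N" "c \<in> B \<rightarrow> carrier S" for B c
    using that
  proof (induction B)
    case (insert b B)
    have terms: "(\<lambda>b. c b \<odot>\<^bsub>E\<^esub> \<tau> b) \<in> B \<rightarrow> carrier E" "c b \<odot>\<^bsub>E\<^esub> \<tau> b \<in> carrier E"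
      using insert.prems by (auto simp: Pi_def subset_iff)
    have "c b \<odot>\<^bsub>E\<^esub> \<tau> b \<in> E.span (\<tau> ` carrier N)"
      using insert.prems by (intro W.smult_closed sub) auto
    moreover have "(\<Oplus>\<^bsub>E\<^esub>b\<in>B. c b \<odot>\<^bsub>E\<^esub> \<tau> b) \<in> E.span (\<tau> ` carrier N)"
      using insert.prems by (intro insert.IH) auto
    ultimately show ?case
      unfolding E.finsum_insert[OF insert.hyps terms] by (rule W.m_closed)
  qed simp
  show "carrier E \<subseteq> E.span (\<tau> ` carrier N)"
  proof
    fix y assume "y \<in> carrier E"
    then obtain B c where "finite B" "B \<subseteq> carrier N" "c \<in> B \<rightarrow> carrier S"
      "y = (\<Oplus>\<^bsub>E\<^esub>b\<in>B. c b \<odot>\<^bsub>E\<^esub> \<tau> b)"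
      using extension_expansion by blast
    then show "y \<in> E.span (\<tau> ` carrier N)"
      by (simp only: lincomb)
  qed
qed

lemma type_algebra_simps [simp]:
  "carrier ring_of_type_algebra = UNIV"
  "x \<otimes>\<^bsub>ring_of_type_algebra\<^esub> y = x * y"
  "x \<oplus>\<^bsub>ring_of_type_algebra\<^esub> y = x + y"
  "\<one>\<^bsub>ring_of_type_algebra\<^esub> = 1"
  "\<zero>\<^bsub>ring_of_type_algebra\<^esub> = 0"
  "(x :: 'x :: comm_ring_1) [^]\<^bsub>ring_of_type_algebra\<^esub> (n :: nat) = x ^ n"
  by (simp_all add: ring_of_type_algebra_def nat_pow_def, induction n) (simp_all add: mult.commute)

section \<open>The skein module and its specialisations\<close>

lemma skein_module_is_module: "Module.module ZA (skein_module M \<A>)"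
  unfolding skein_module_def
proof (rule presented_module_is_module)
  show cr: "cring ZA"
    by (rule cring_from_type_algebra)
  interpret F: Module.module ZA "free_module ZA (link_classes M \<A>)"
    using cr by (rule free_module_is_module)
  \<comment> \<open>Both kinds of Kauffman relation involve framed links only, so every generator in
    them belongs to \<open>link_classes\<close>.\<close>
  have "gen ZA (isotopy_class M \<A> L) \<in> carrier (free_module ZA (link_classes M \<A>))"
    if "framed_link \<A> L" for L
    using that unfolding link_classes_def by (intro gen_closed[OF cr]) blast
  then show "kauffman_relations M \<A> \<subseteq> carrier (free_module ZA (link_classes M \<A>))"
    unfolding kauffman_relations_def Let_def kauffman_triple_def adds_trivial_unknot_def
    by (auto intro!: F.M.minus_closed F.M.a_closed F.smult_closed)
qed

lemma scalar_extension_type_algebra: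
  fixes f :: "'r::comm_ring_1 \<Rightarrow> 's::comm_ring_1"
  assumes "Module.module ring_of_type_algebra N"
  shows "scalar_extension ring_of_type_algebra ring_of_type_algebra N f"
  using assms by (auto simp: scalar_extension_def scalar_extension_axioms_def cring_from_type_algebra)

text \<open>Phrased by coefficients indexed by \<open>B\<close> rather than by the image of
  \<open>B\<close>: for finite \<open>B\<close> over a nonzero ring this also forces
  \<open>tensor_one\<close> to be injective on \<open>B\<close>.\<close>

definition independent_in_extension ::
  "('r, 'm) ring_scheme \<Rightarrow> ('s, 'l) ring_scheme \<Rightarrow> ('r \<Rightarrow> 's) \<Rightarrow> ('r, 'n) module \<Rightarrow> 'n set \<Rightarrow> bool" where
  "independent_in_extension R S \<phi> N B \<longleftrightarrow> (let E = extend_scalars R S \<phi> N in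
     \<forall>c \<in> B \<rightarrow> carrier S. (\<Oplus>\<^bsub>E\<^esub>b\<in>B. c b \<odot>\<^bsub>E\<^esub> tensor_one R S \<phi> N b) = \<zero>\<^bsub>E\<^esub> \<longrightarrow>
       (\<forall>b\<in>B. c b = \<zero>\<^bsub>S\<^esub>))"

lemma laurent_relation:
  assumes N: "Module.module ZA N"
    and fin: "vdim QA (extend_scalars ZA QA (laurent_eval QA_var) N) = enat d"
    and B: "finite B" "B \<subseteq> carrier N" "d < card B"
  shows "\<exists>g. (\<exists>b\<in>B. g b \<noteq> 0) \<and> (\<Oplus>\<^bsub>N\<^esub>b\<in>B. g b \<odot>\<^bsub>N\<^esub> b) = \<zero>\<^bsub>N\<^esub>"
proof -
  interpret Q: scalar_extension ZA QA N "laurent_eval QA_var"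
    using N by (rule scalar_extension_type_algebra)
  interpret h: coefficient_hom of_int QA_var
    by (rule coefficient_hom_QA)
  have field: "field QA"
    by (rule field_from_type_algebra)
  interpret V: vectorspace QA Q.E
    by (intro vectorspace.intro Q.E.module_axioms field)
  \<comment> \<open>A finite value of \<open>vdim\<close> records finite-dimensionality as well as
    the dimension.\<close>
  have "V.fin_dim" "V.dim = d"
    using fin by (auto simp: vdim_def split: if_splits)
  moreover have "Q.\<tau> \<in> B \<rightarrow> carrier Q.E"
    using B(2) by auto
  ultimately obtain c where c: "c \<in> B \<rightarrow> carrier QA" "\<exists>b\<in>B. c b \<noteq> \<zero>\<^bsub>QA\<^esub>"
    "(\<Oplus>\<^bsub>Q.E\<^esub>b\<in>B. c b \<odot>\<^bsub>Q.E\<^esub> Q.\<tau> b) = \<zero>\<^bsub>Q.E\<^esub>"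
    using V.dependent_family[OF _ B(1)] B(3) by blast
  have "\<exists>g \<in> B \<rightarrow> carrier ZA. (\<exists>b\<in>B. g b \<noteq> \<zero>\<^bsub>ZA\<^esub>) \<and> (\<Oplus>\<^bsub>N\<^esub>b\<in>B. g b \<odot>\<^bsub>N\<^esub> b) = \<zero>\<^bsub>N\<^esub>"
  proof (rule Q.extension_relation_clear_denominators[OF _ _ _ _ B(1,2) c(1,3,2)])
    show "laurent_eval QA_var \<in> ring_hom ZA QA"
      by (intro ring_hom_memI) (simp_all add: laurent_eval_eq h.eval_mult h.eval_add h.eval_1)
    show "domain QA"
      using field by (simp add: field_def)
    fix s
    obtain p q where "laurent_eval QA_var q \<noteq> 0" "laurent_eval QA_var q * s = laurent_eval QA_var p"
      using laurent_eval_QA_fractions[of s] by blast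
    then show "\<exists>a\<in>carrier ZA. \<exists>b\<in>carrier ZA. laurent_eval QA_var b \<noteq> \<zero>\<^bsub>QA\<^esub> \<and>
        laurent_eval QA_var b \<otimes>\<^bsub>QA\<^esub> s = laurent_eval QA_var a"
      by (intro bexI[of _ p] bexI[of _ q]) simp_all
  qed (simp add: laurent_eval_QA_inj)
  then show ?thesis
    by auto
qed

lemma independent_family_at:
  assumes N: "Module.module ZA N"
    and d: "enat d < vdim CC (extend_scalars ZA CC (laurent_eval \<zeta>) N)"
  shows "\<exists>B. finite B \<and> B \<subseteq> carrier N \<and> d < card B \<and>
    independent_in_extension ZA CC (laurent_eval \<zeta>) N B"
proof -
  interpret C: scalar_extension ZA CC N "laurent_eval \<zeta>"
    using N by (rule scalar_extension_type_algebra)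
  have V: "vectorspace CC C.E"
    by (intro vectorspace.intro C.E.module_axioms field_from_type_algebra)
  then interpret V: vectorspace CC C.E .
  have "C.\<tau> ` carrier N \<subseteq> carrier C.E"
    by auto
  then obtain B' where B': "B' \<subseteq> C.\<tau> ` carrier N" "finite B'" "\<not> LinearCombinations.module.lin_dep CC C.E B'" "d < card B'"
    using independent_family[OF V _ C.span_tensor_one d] by blast
  \<comment> \<open>One preimage is chosen for each vector, so \<open>\<tau>\<close> is injective on
    \<open>B\<close> and the cardinality is kept.\<close>
  then obtain B where B: "B \<subseteq> carrier N" "inj_on C.\<tau> B" "B' = C.\<tau> ` B"
    by (auto simp: subset_image_inj)
  have fin: "finite B" "d < card B"
    using B B' by (auto simp: finite_image_iff card_image)
  have closed: "C.\<tau> \<in> B \<rightarrow> carrier C.E"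
    using B(1) by auto
  have "c b = 0" if "(\<Oplus>\<^bsub>C.E\<^esub>b\<in>B. c b \<odot>\<^bsub>C.E\<^esub> C.\<tau> b) = \<zero>\<^bsub>C.E\<^esub>" "b \<in> B" for c b
    using V.independent_family_coefficients[OF fin(1) B(2) closed _ _ that] B(3) B'(3) by simp
  with fin B show ?thesis
    by (auto simp: independent_in_extension_def Let_def)
qed

text \<open>For an integer root the common power of \<open>A - u\<close> can be divided out over the
  integers, so the torsion element lies in \<open>N\<close> itself.\<close>

lemma integral_torsion:
  assumes N: "Module.module ZA N" and u: "\<zeta> = of_int u" "\<zeta> \<noteq> 0"
    and B: "finite B" "B \<subseteq> carrier N"
    and indep: "independent_in_extension ZA CC (laurent_eval \<zeta>) N B"
    and g: "\<exists>b\<in>B. g b \<noteq> 0" "(\<Oplus>\<^bsub>N\<^esub>b\<in>B. g b \<odot>\<^bsub>N\<^esub> b) = \<zero>\<^bsub>N\<^esub>"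
  shows "has_power_torsion ZA N (laurent_A - laurent_const u)"
proof -
  interpret C: scalar_extension ZA CC N "laurent_eval \<zeta>"
    using N by (rule scalar_extension_type_algebra)
  have "coefficient_hom of_int (of_int u :: complex)"
    using u by unfold_locales auto
  then obtain k g' where k: "\<And>b. b \<in> B \<Longrightarrow> g b = (laurent_A - laurent_const u) ^ k * g' b"
    and g': "\<exists>b\<in>B. laurent_eval \<zeta> (g' b) \<noteq> 0"
    using laurent_family_divide_root[of "of_int :: int \<Rightarrow> complex" u B g] B(1) g(1)
    by (auto simp: laurent_eval_eq u(1))
  have "(\<Oplus>\<^bsub>N\<^esub>b\<in>B. g' b \<odot>\<^bsub>N\<^esub> b) \<noteq> \<zero>\<^bsub>N\<^esub>"
  proof
    assume "(\<Oplus>\<^bsub>N\<^esub>b\<in>B. g' b \<odot>\<^bsub>N\<^esub> b) = \<zero>\<^bsub>N\<^esub>"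
    then have "(\<Oplus>\<^bsub>C.E\<^esub>b\<in>B. laurent_eval \<zeta> (g' b) \<odot>\<^bsub>C.E\<^esub> C.\<tau> b) = \<zero>\<^bsub>C.E\<^esub>"
      using C.tensor_one_lincomb[OF B(2), of g'] C.tensor_one_zero by auto
    \<comment> \<open>The supposed relation in \<open>N\<close> has specialised to one among
      independent vectors, with a nonzero coefficient.\<close>
    then show False
      using indep g' by (auto simp: independent_in_extension_def Let_def)
  qed
  then show ?thesis
    using has_power_torsionI[OF N B(1), of "\<lambda>b. b" "laurent_A - laurent_const u" g' g k] B(2) k g(2)
    by auto
qed

text \<open>The quotients by the power of \<open>A - \<zeta>\<close> have complex coefficients, so
  the torsion element is found in the extension to complex Laurent polynomials. It is nonzero
  because that extension maps to the specialisation at \<zeta>, where the element has nonzero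
  image.\<close>

lemma complex_torsion:
  assumes N: "Module.module ZA N" and "\<zeta> \<noteq> 0"
    and B: "finite B" "B \<subseteq> carrier N"
    and indep: "independent_in_extension ZA CC (laurent_eval \<zeta>) N B"
    and g: "\<exists>b\<in>B. g b \<noteq> 0" "(\<Oplus>\<^bsub>N\<^esub>b\<in>B. g b \<odot>\<^bsub>N\<^esub> b) = \<zero>\<^bsub>N\<^esub>"
  shows "has_power_torsion CA (extend_scalars ZA CA laurent_to_complex N) (laurent_A - laurent_const \<zeta>)"
proof -
  interpret C: scalar_extension ZA CC N "laurent_eval \<zeta>"
    using N by (rule scalar_extension_type_algebra)
  interpret D: scalar_extension ZA CA N laurent_to_complex
    using N by (rule scalar_extension_type_algebra)
  have id: "coefficient_hom (id :: complex \<Rightarrow> complex) (id \<zeta>)"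
    using \<open>\<zeta> \<noteq> 0\<close> by unfold_locales auto
  then interpret h: coefficient_hom id \<zeta>
    by simp
  let ?p = "\<lambda>b. laurent_to_complex (g b)"
  obtain k p' where k: "\<And>b. b \<in> B \<Longrightarrow> ?p b = (laurent_A - laurent_const \<zeta>) ^ k * p' b"
    and p': "\<exists>b\<in>B. laurent_hom_eval id \<zeta> (p' b) \<noteq> 0"
    using laurent_family_divide_root[OF id _ B(1), of ?p] g(1)
    by (auto simp: laurent_to_complex_eq_0_iff)
  have zero: "(\<Oplus>\<^bsub>D.E\<^esub>b\<in>B. ?p b \<odot>\<^bsub>D.E\<^esub> D.\<tau> b) = \<zero>\<^bsub>D.E\<^esub>"
    using D.tensor_one_lincomb[OF B(2), of g] D.tensor_one_zero g(2) by auto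
  \<comment> \<open>The target of the map that sends \<open>n \<otimes> 1\<close> to
    \<open>n \<otimes> 1\<close> and lets \<open>A\<close> act as \<zeta>.\<close>
  let ?V = "restrict_scalars (laurent_hom_eval id \<zeta>) C.E"
  have V: "Module.module CA ?V"
    by (intro restrict_scalars_module[of _ CC] cring_from_type_algebra C.E.module_axioms ring_hom_memI)
      (simp_all add: h.eval_mult h.eval_add h.eval_1)
  have "(\<Oplus>\<^bsub>D.E\<^esub>b\<in>B. p' b \<odot>\<^bsub>D.E\<^esub> D.\<tau> b) \<noteq> \<zero>\<^bsub>D.E\<^esub>"
  proof
    assume *: "(\<Oplus>\<^bsub>D.E\<^esub>b\<in>B. p' b \<odot>\<^bsub>D.E\<^esub> D.\<tau> b) = \<zero>\<^bsub>D.E\<^esub>"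
    have "(\<Oplus>\<^bsub>?V\<^esub>b\<in>B. p' b \<odot>\<^bsub>?V\<^esub> C.\<tau> b) = \<zero>\<^bsub>?V\<^esub>"
      by (rule D.extension_relation_map[OF V _ _ _ B _ *])
        (simp_all add: C.tensor_one_add C.tensor_one_smult laurent_hom_eval_to_complex)
    then have "(\<Oplus>\<^bsub>C.E\<^esub>b\<in>B. laurent_hom_eval id \<zeta> (p' b) \<odot>\<^bsub>C.E\<^esub> C.\<tau> b) = \<zero>\<^bsub>C.E\<^esub>"
      using B(2) by (subst (asm) restrict_scalars_finsum[OF V C.E.module_axioms]) (auto simp: subset_iff)
    then show False
      using indep p' by (auto simp: independent_in_extension_def Let_def)
  qed
  then show ?thesis
    using has_power_torsionI[OF D.E.module_axioms B(1), of D.\<tau> "laurent_A - laurent_const \<zeta>" p' ?p k]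
      B(2) k zero by (auto simp: subset_iff)
qed

theorem theorem2p1:
  fixes M :: "'a topology" and \<A> :: "'a chart set" and \<zeta> :: complex
  assumes "closed_oriented_3manifold M \<A>"
    and "\<zeta> \<noteq> 0"
    and "vdim CC (skein_module_at \<zeta> M \<A>) > vdim QA (skein_module_QA M \<A>)"
  shows "skein_has_torsion M \<A> \<zeta>"
proof -
  let ?N = "skein_module M \<A>"
  note N = skein_module_is_module[of M \<A>]
  \<comment> \<open>Being strictly below another extended natural number, the dimension over the
    rational functions is finite.\<close>
  obtain d where d: "vdim QA (skein_module_QA M \<A>) = enat d"
    using assms(3) by (metis enat_ord_simps(6) not_enat_eq)
  obtain B where B: "finite B" "B \<subseteq> carrier ?N" "d < card B"
    and indep: "independent_in_extension ZA CC (laurent_eval \<zeta>) ?N B"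
    using independent_family_at[OF N, of d \<zeta>] assms(3) d unfolding skein_module_at_def by auto
  obtain g where g: "\<exists>b\<in>B. g b \<noteq> 0" "(\<Oplus>\<^bsub>?N\<^esub>b\<in>B. g b \<odot>\<^bsub>?N\<^esub> b) = \<zero>\<^bsub>?N\<^esub>"
    using laurent_relation[OF N d[unfolded skein_module_QA_def] B] by blast
  \<comment> \<open>Read at \<open>u = 1\<close> and \<open>u = -1\<close>, where torsion is defined
    over the integers; every other \<zeta> falls under the complex case.\<close>
  have "has_power_torsion ZA ?N (laurent_A - laurent_const u)" if "\<zeta> = of_int u" for u
    using integral_torsion[OF N that assms(2) B(1,2) indep g] .
  moreover have "has_power_torsion CA (skein_module_CA M \<A>) (laurent_A - laurent_const \<zeta>)"
    unfolding skein_module_CA_def using complex_torsion[OF N assms(2) B(1,2) indep g] .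
  ultimately show ?thesis
    by (auto simp: skein_has_torsion_def)
qed

end
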